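(* Let $a<b$ be real numbers, let $\Gamma$ be a set and let $K\subset[a,b]^\Gamma$ be a compact space. The following are equivalent: (1) $K$ is a continuous image of an RN compactum. (2) There exist a function $u:\Gamma\to\mathcal{N}$ and a family of compact sets $K_s\subset[a,b]^\Gamma$, for $s\in\mathbb{N}^{<\omega}$, such that (a) $d_{u^{-1}(\mathcal{N}_s)}$ fragments $K_s$ for every $s\in\mathbb{N}^{<\omega}$, and (b) for every $s\in\mathbb{N}^{<\omega}$ of length $n>0$ and every $x\in K$ there exists $y\in K_s$ such that $d_{u^{-1}(\mathcal{N}_s)}(x,y)\leq\frac{1}{2^n}$.
   Context: Compact spaces are Hausdorff; products of intervals carry the product topology. $\mathcal{N}=\mathbb{N}^{\mathbb{N}}$ is the set of infinite sequences of natural numbers ($0\in\mathbb{N}$), $\mathbb{N}^{<\omega}$ is the set of finite sequences of natural numbers, and for $s\in\mathbb{N}^{<\omega}$, $\mathcal{N}_s$ is the set of $\sigma\in\mathcal{N}$ having $s$ as an initial segment. For $\Delta\subset\Gamma$ and $x,y\in[a,b]^\Gamma$, $d_\Delta(x,y)=\sup\{|x_\gamma-y_\gamma|:\gamma\in\Delta\}$ (with value $0$ if $\Delta=\emptyset$). A map $d:K\times K\to\mathbb{R}$ on a topological space $K$ $\varepsilon$-fragments $K$ if every nonempty closed set $L\subset K$ has a nonempty relatively open subset $U$ with $\sup\{d(x,y):x,y\in U\}<\varepsilon$; $d$ fragments $K$ if it $\varepsilon$-fragments $K$ for every $\varepsilon>0$. A compact space $K$ is RN (Radon-Nikodým) compact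 if there is a lower semicontinuous metric $d:K\times K\to\mathbb{R}$ which fragments $K$ (equivalently, $K$ is homeomorphic to a weak$^*$ compact subset of a dual Banach space with the Radon-Nikodým property; equivalently, $K$ embeds in some $[-1,1]^{\Gamma'}$ so that $d_{\Gamma'}$ fragments $K$). *)

theory Defs
  imports "HOL-Analysis.Analysis"
begin

definition lower_semicontinuous_map :: "'a topology \<Rightarrow> ('a \<Rightarrow> real) \<Rightarrow> bool" where
  "lower_semicontinuous_map X f \<longleftrightarrow> (\<forall>r. openin X {x \<in> topspace X. r < f x})"

text \<open>The supremum is taken in the extended reals, so that an unbounded set has supremum
  \<open>\<infinity>\<close>; the map \<open>d\<close> itself need not be a metric.\<close>

definition eps_fragments :: "'a topology \<Rightarrow> ('a \<Rightarrow> 'a \<Rightarrow> real) \<Rightarrow> real \<Rightarrow> bool" where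
  "eps_fragments X d \<epsilon> \<longleftrightarrow>
     (\<forall>L. closedin X L \<and> L \<noteq> {} \<longrightarrow>
        (\<exists>U. openin (subtopology X L) U \<and> U \<noteq> {} \<and>
             (SUP (x, y) \<in> U \<times> U. ereal (d x y)) < ereal \<epsilon>))"

definition fragments :: "'a topology \<Rightarrow> ('a \<Rightarrow> 'a \<Rightarrow> real) \<Rightarrow> bool" where
  "fragments X d \<longleftrightarrow> (\<forall>\<epsilon>>0. eps_fragments X d \<epsilon>)"

definition RN_compact :: "'a topology \<Rightarrow> bool" where
  "RN_compact X \<longleftrightarrow> compact_space X \<and> Hausdorff_space X \<and>
     (\<exists>d. Metric_space (topspace X) d \<and>
          lower_semicontinuous_map (prod_topology X X) (\<lambda>(x, y). d x y) \<and>
          fragments X d)"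

text \<open>A formula cannot quantify over types, so the RN compactum has to live on a fixed type.
  Taking points in \<open>'a set set\<close> is no restriction: by \<open>RN_image_if_RN_compact\<close> below, every
  continuous image of an RN compactum on any type whatsoever satisfies this predicate.\<close>

definition RN_image :: "'a topology \<Rightarrow> bool" where
  "RN_image X \<longleftrightarrow>
     (\<exists>(Y :: 'a set set topology) f.
        RN_compact Y \<and> continuous_map Y X f \<and> f ` topspace Y = topspace X)"

definition cube :: "real \<Rightarrow> real \<Rightarrow> 'g set \<Rightarrow> ('g \<Rightarrow> real) topology" where
  "cube a b \<Gamma> = product_topology (\<lambda>_. top_of_set {a..b}) \<Gamma>"

definition sup_dist :: "'g set \<Rightarrow> ('g \<Rightarrow> real) \<Rightarrow> ('g \<Rightarrow> real) \<Rightarrow> real" where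
  "sup_dist \<Delta> x y = (if \<Delta> = {} then 0 else SUP \<gamma>\<in>\<Delta>. \<bar>x \<gamma> - y \<gamma>\<bar>)"

definition cylinder :: "nat list \<Rightarrow> (nat \<Rightarrow> nat) set" where
  "cylinder s = {\<sigma>. \<forall>i<length s. \<sigma> i = s ! i}"

lemma RN_compact_inj:
  assumes X: "RN_compact X" and Y: "compact_space Y" "Hausdorff_space Y"
    and g: "continuous_map Y X g" "inj_on g (topspace Y)"
  shows "RN_compact Y"
proof -
  from X have HX: "Hausdorff_space X" by (simp add: RN_compact_def)
  from X obtain d where d: "Metric_space (topspace X) d"
    and l: "lower_semicontinuous_map (prod_topology X X) (\<lambda>(x, y). d x y)"
    and fr: "fragments X d" by (auto simp: RN_compact_def)
  have gt: "g x \<in> topspace X" if "x \<in> topspace Y" for x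
    using g(1) that by (auto simp: continuous_map_def)
  interpret Metric_space "topspace X" d by fact
  let ?d = "\<lambda>x y. d (g x) (g y)"
  have m: "Metric_space (topspace Y) ?d"
    by unfold_locales (use g(2) in \<open>auto simp: commute gt triangle inj_on_eq_iff\<close>)
  have l': "lower_semicontinuous_map (prod_topology Y Y) (\<lambda>(x, y). ?d x y)"
    unfolding lower_semicontinuous_map_def
  proof
    fix r
    have c: "continuous_map (prod_topology Y Y) (prod_topology X X) (\<lambda>(x, y). (g x, g y))"
      using g(1) by (simp add: continuous_map_prod_top)
    have "openin (prod_topology X X) {x \<in> topspace (prod_topology X X). r < (\<lambda>(x, y). d x y) x}"
      using l by (auto simp: lower_semicontinuous_map_def)
    from openin_continuous_map_preimage[OF c this]
    have "openin (prod_topology Y Y) {z \<in> topspace (prod_topology Y Y).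
       (\<lambda>(x, y). (g x, g y)) z \<in> {x \<in> topspace (prod_topology X X). r < (\<lambda>(x, y). d x y) x}}" .
    moreover have "{z \<in> topspace (prod_topology Y Y).
       (\<lambda>(x, y). (g x, g y)) z \<in> {x \<in> topspace (prod_topology X X). r < (\<lambda>(x, y). d x y) x}}
       = {z \<in> topspace (prod_topology Y Y). r < (\<lambda>(x, y). ?d x y) z}"
      using gt by auto
    ultimately show "openin (prod_topology Y Y)
        {z \<in> topspace (prod_topology Y Y). r < (\<lambda>(x, y). ?d x y) z}" by simp
  qed
  have "fragments Y ?d"
    unfolding fragments_def eps_fragments_def
  proof (intro allI impI)
    fix \<epsilon> :: real and L
    assume e: "\<epsilon> > 0" and L: "closedin Y L \<and> L \<noteq> {}"
    have LY: "L \<subseteq> topspace Y" using L closedin_subset by blast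
    have "compactin X (g ` L)"
      using L Y g(1) by (blast intro: image_compactin closedin_compact_space)
    hence "closedin X (g ` L)" using HX compactin_imp_closedin by blast
    then obtain U where U: "openin (subtopology X (g ` L)) U" "U \<noteq> {}"
      "(SUP (x, y) \<in> U \<times> U. ereal (d x y)) < ereal \<epsilon>"
      using fr e L unfolding fragments_def eps_fragments_def by blast
    from U(1) obtain T where T: "openin X T" "U = T \<inter> g ` L"
      by (auto simp: openin_subtopology)
    let ?V = "{x \<in> topspace Y. g x \<in> T} \<inter> L"
    have "openin (subtopology Y L) ?V"
      using openin_continuous_map_preimage[OF g(1) T(1)] by (auto simp: openin_subtopology)
    moreover have "?V \<noteq> {}" using U(2) T(2) LY by auto
    moreover have "(SUP (x, y) \<in> ?V \<times> ?V. ereal (?d x y)) \<le> (SUP (x, y) \<in> U \<times> U. ereal (d x y))"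
    proof (rule SUP_least)
      fix z assume "z \<in> ?V \<times> ?V"
      then obtain x y where "z = (x, y)" "(g x, g y) \<in> U \<times> U" using T(2) by auto
      then show "(case z of (x, y) \<Rightarrow> ereal (?d x y)) \<le> (SUP (x, y) \<in> U \<times> U. ereal (d x y))"
        using SUP_upper[of "(g x, g y)" "U \<times> U" "\<lambda>(x, y). ereal (d x y)"] by auto
    qed
    ultimately show "\<exists>U. openin (subtopology Y L) U \<and> U \<noteq> {} \<and>
             (SUP (x, y) \<in> U \<times> U. ereal (?d x y)) < ereal \<epsilon>"
      using U(3) by (meson le_less_trans)
  qed
  with m l' Y show ?thesis unfolding RN_compact_def by (intro conjI exI[of _ ?d])
qed

lemma RN_image_if_RN_compact:
  fixes L :: "'l topology" and X :: "'a topology"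
  assumes L: "RN_compact L" and f: "continuous_map L X f" "f ` topspace L = topspace X"
  shows "RN_image X"
proof -
  have "\<forall>k\<in>topspace X. \<exists>y. y \<in> topspace L \<and> f y = k"
    unfolding f(2)[symmetric] by blast
  then obtain p where p: "\<And>k. k \<in> topspace X \<Longrightarrow> p k \<in> topspace L \<and> f (p k) = k"
    using bchoice[of "topspace X" "\<lambda>k y. y \<in> topspace L \<and> f y = k"] by blast
  define S where "S = L closure_of (p ` topspace X)"
  define h where "h x = {{k \<in> topspace X. p k \<in> U} | U. openin L U \<and> x \<in> U}" for x
  have SL: "S \<subseteq> topspace L" by (simp add: S_def closure_of_subset_topspace)
  have pS: "p ` topspace X \<subseteq> S" unfolding S_def
    by (rule closure_of_subset) (use p in auto)
  have HL: "Hausdorff_space L" and CL: "compact_space L" using L by (auto simp: RN_compact_def)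
  have inj: "inj_on h S"
  proof (rule inj_onI, rule ccontr)
    fix x y assume xy: "x \<in> S" "y \<in> S" "h x = h y" "x \<noteq> y"
    then obtain U V where UV: "openin L U" "openin L V" "x \<in> U" "y \<in> V" "disjnt U V"
      using HL SL unfolding Hausdorff_space_def by (metis subsetD)
    then have "{k \<in> topspace X. p k \<in> U} \<in> h y" using xy by (auto simp: h_def)
    then obtain W where W: "openin L W" "y \<in> W"
      "{k \<in> topspace X. p k \<in> U} = {k \<in> topspace X. p k \<in> W}" by (auto simp: h_def)
    have "openin L (V \<inter> W)" "y \<in> V \<inter> W" using W UV by auto
    moreover have "\<exists>z\<in>p ` topspace X. z \<in> T" if "y \<in> T" "openin L T" for T
      using xy(2) that unfolding S_def in_closure_of by blast
    ultimately obtain k where "k \<in> topspace X" "p k \<in> V \<inter> W" by blast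
    then have "p k \<in> U" "p k \<in> V" using W(3) by auto
    then show False using UV(5) by (auto simp: disjnt_iff)
  qed
  define g where "g = inv_into S h"
  define Y where "Y = pullback_topology (h ` S) g (subtopology L S)"
  have gS: "g z \<in> S" if "z \<in> h ` S" for z unfolding g_def using that by (rule inv_into_into)
  have gh: "g (h x) = x" if "x \<in> S" for x unfolding g_def using inj that by simp
  have tS: "topspace (subtopology L S) = S" using SL by auto
  have tY: "topspace Y = h ` S"
    unfolding Y_def topspace_pullback_topology tS using gS by auto
  have gi: "inj_on g (h ` S)" unfolding g_def by (rule inj_on_inv_into) simp
  have gim: "g ` (h ` S) = S" using gh gS by force
  have "homeomorphic_map Y (subtopology L S) g"
  proof (rule bijective_open_imp_homeomorphic_map)
    show "continuous_map Y (subtopology L S) g"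
      unfolding Y_def using continuous_map_pullback[of "subtopology L S" "subtopology L S" id]
      by simp
    show "open_map Y (subtopology L S) g"
      unfolding open_map_def
    proof (intro allI impI)
      fix U assume "openin Y U"
      then obtain T where T: "openin (subtopology L S) T" "U = g -` T \<inter> h ` S"
        unfolding Y_def openin_pullback_topology by auto
      have "T \<subseteq> S" using openin_subset[OF T(1)] tS by simp
      have "g ` U = T"
      proof
        show "g ` U \<subseteq> T" using T(2) by auto
        show "T \<subseteq> g ` U"
        proof
          fix x assume "x \<in> T"
          then have "x = g (h x)" "h x \<in> U" using gh T(2) \<open>T \<subseteq> S\<close> by auto
          then show "x \<in> g ` U" by (rule image_eqI)
        qed
      qed
      then show "openin (subtopology L S) (g ` U)" using T(1) by simp
    qed
    show "g ` topspace Y = topspace (subtopology L S)" using tY tS gim by simp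
    show "inj_on g (topspace Y)" using tY gi by simp
  qed
  then have hom: "Y homeomorphic_space subtopology L S" and gc: "continuous_map Y (subtopology L S) g"
    using homeomorphic_map_imp_homeomorphic_space homeomorphic_imp_continuous_map by blast+
  have gL: "continuous_map Y L g" using gc by (simp add: continuous_map_in_subtopology)
  have "closedin L S" by (simp add: S_def)
  then have "compact_space (subtopology L S)"
    using CL by (simp add: closedin_compact_space compact_space_subtopology)
  then have CY: "compact_space Y" using hom homeomorphic_compact_space by blast
  have HY: "Hausdorff_space Y"
    using hom HL homeomorphic_Hausdorff_space Hausdorff_space_subtopology by blast
  have RY: "RN_compact Y" using RN_compact_inj[OF L CY HY gL] tY gi by simp
  have fg: "continuous_map Y X (f \<circ> g)" using continuous_map_compose[OF gL f(1)] .
  have "(f \<circ> g) ` topspace Y = f ` S" using tY gim by (metis image_comp)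
  also have "\<dots> = topspace X"
  proof
    show "f ` S \<subseteq> topspace X" using f(2) SL by blast
    show "topspace X \<subseteq> f ` S" using p pS by (metis imageI image_subset_iff subsetI)
  qed
  finally show ?thesis unfolding RN_image_def using RY fg
    by (intro exI[of _ Y] exI[of _ "f \<circ> g"] conjI)
qed

end

theory Submission
  imports Defs
begin

text \<open>
  Suppose that \<open>f\<close> maps an RN compactum \<open>(L, d)\<close> onto \<open>K\<close>, let \<open>\<gamma> \<in> \<Gamma>\<close> and \<open>\<epsilon> = 1 / 2 ^ (N + 1)\<close>. By
  compactness there is \<open>m\<close> such that \<open>d x y \<le> 1 / (m + 1)\<close> implies \<open>\<bar>f x \<gamma> - f y \<gamma>\<bar> < \<epsilon>\<close>. Starting from
  the level sets of \<open>f \<gamma>\<close> at multiples of \<open>\<epsilon>\<close>, a dyadic Urysohn construction that keeps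
  track of \<open>d\<close>-distances (\<open>d\<close>-neighbourhoods of closed sets are closed because \<open>d\<close> is lower
  semicontinuous) gives a continuous function \<open>g\<close> within \<open>\<epsilon>\<close> of \<open>f \<gamma>\<close> whose modulus of continuity
  with respect to \<open>d\<close> depends only on \<open>m\<close> and \<open>\<epsilon>\<close>. Put \<open>u \<gamma> N = m\<close>. The functions \<open>g\<close> obtained from the
  \<open>\<gamma>\<close> with \<open>u \<gamma> \<in> cylinder s\<close>, where \<open>length s = N + 1\<close>, are then \<open>d\<close>-equicontinuous, and the image
  of \<open>L\<close> under them is \<open>Ks s\<close>.

  Conversely, let \<open>L\<close> be the set of those \<open>z\<close> in the product of \<open>K\<close> and the restrictions of the \<open>Ks s\<close>
  to \<open>\<Delta> s = {\<gamma> \<in> \<Gamma>. u \<gamma> \<in> cylinder s}\<close> whose coordinate in \<open>Ks s\<close> is \<open>1 / 2 ^ length s\<close>-close to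
  the one in \<open>K\<close> for all \<open>s \<noteq> []\<close>. The coordinates in the \<open>Ks s\<close> determine the one in \<open>K\<close>, so a weighted
  supremum of the countably many distances on \<open>\<Delta> s\<close> is a lower semicontinuous metric
  fragmenting \<open>L\<close>, and \<open>L\<close> projects onto \<open>K\<close>.
\<close>

section \<open>Fragmentability\<close>

text \<open>Because \<epsilon> is arbitrary, the strict bound on the extended supremum may be traded
  for a non-strict pointwise bound: each value is below the supremum, and conversely the pointwise
  bound is used at \<epsilon> / 2.\<close>

lemma fragments_iff:
  "fragments X d \<longleftrightarrow>
     (\<forall>\<epsilon>>0. \<forall>L. closedin X L \<and> L \<noteq> {} \<longrightarrow>
        (\<exists>U. openin (subtopology X L) U \<and> U \<noteq> {} \<and> (\<forall>x\<in>U. \<forall>y\<in>U. d x y \<le> \<epsilon>)))"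
  (is "_ = ?R")
proof
  assume fr: "fragments X d"
  show ?R
  proof (intro allI impI)
    fix \<epsilon> :: real and L
    assume "\<epsilon> > 0" "closedin X L \<and> L \<noteq> {}"
    then obtain U where U: "openin (subtopology X L) U" "U \<noteq> {}"
      "(SUP (x, y) \<in> U \<times> U. ereal (d x y)) < ereal \<epsilon>"
      using fr unfolding fragments_def eps_fragments_def by blast
    have "d x y \<le> \<epsilon>" if "x \<in> U" "y \<in> U" for x y
    proof -
      have "ereal (d x y) \<le> (SUP (x, y) \<in> U \<times> U. ereal (d x y))"
        using that by (intro SUP_upper2[of "(x, y)"]) auto
      then have "ereal (d x y) < ereal \<epsilon>" using U(3) by (rule le_less_trans)
      then show ?thesis by simp
    qed
    then show "\<exists>U. openin (subtopology X L) U \<and> U \<noteq> {} \<and> (\<forall>x\<in>U. \<forall>y\<in>U. d x y \<le> \<epsilon>)"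
      using U by blast
  qed
next
  assume R: ?R
  show "fragments X d"
    unfolding fragments_def eps_fragments_def
  proof (intro allI impI)
    fix \<epsilon> :: real and L
    assume e: "\<epsilon> > 0" and L: "closedin X L \<and> L \<noteq> {}"
    obtain U where U: "openin (subtopology X L) U" "U \<noteq> {}" "\<forall>x\<in>U. \<forall>y\<in>U. d x y \<le> \<epsilon> / 2"
      using R e L by (meson half_gt_zero)
    have "(SUP (x, y) \<in> U \<times> U. ereal (d x y)) \<le> ereal (\<epsilon> / 2)"
      using U(3) by (intro SUP_least) auto
    also have "\<dots> < ereal \<epsilon>" using e by simp
    finally show "\<exists>U. openin (subtopology X L) U \<and> U \<noteq> {} \<and>
        (SUP (x, y) \<in> U \<times> U. ereal (d x y)) < ereal \<epsilon>"
      using U by blast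
  qed
qed

text \<open>The image of \<open>L\<close> is compact, hence closed in the Hausdorff space
  \<open>Y\<close>; the preimage in \<open>L\<close> of an open piece of that image with small
  diameter is the required piece of \<open>L\<close>.\<close>

lemma fragments_pullback:
  assumes X: "compact_space X" and Y: "Hausdorff_space Y" and g: "continuous_map X Y g"
    and fr: "fragments Y d"
  shows "fragments X (\<lambda>x y. d (g x) (g y))"
  unfolding fragments_iff
proof (intro allI impI)
  fix \<epsilon> :: real and L
  assume e: "\<epsilon> > 0" and L: "closedin X L \<and> L \<noteq> {}"
  have "compactin Y (g ` L)"
    using L X g by (blast intro: image_compactin closedin_compact_space)
  then have "closedin Y (g ` L)" using Y compactin_imp_closedin by blast
  then obtain U where U: "openin (subtopology Y (g ` L)) U" "U \<noteq> {}" "\<forall>x\<in>U. \<forall>y\<in>U. d x y \<le> \<epsilon>"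
    using fr[unfolded fragments_iff, rule_format, of \<epsilon> "g ` L"] e L by auto
  obtain T where T: "openin Y T" "U = T \<inter> g ` L"
    using U(1) by (auto simp: openin_subtopology)
  let ?V = "{x \<in> topspace X. g x \<in> T} \<inter> L"
  have "openin (subtopology X L) ?V"
    using openin_continuous_map_preimage[OF g T(1)] by (auto simp: openin_subtopology)
  moreover have "?V \<noteq> {}" using U(2) T(2) closedin_subset L by fastforce
  moreover have "\<forall>x\<in>?V. \<forall>y\<in>?V. d (g x) (g y) \<le> \<epsilon>" using U(3) T(2) by auto
  ultimately show "\<exists>V. openin (subtopology X L) V \<and> V \<noteq> {} \<and> (\<forall>x\<in>V. \<forall>y\<in>V. d (g x) (g y) \<le> \<epsilon>)"
    by blast
qed

text \<open>Zorn's lemma on the open complements: the union of a chain stays admissible because the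
  fibre of each point of \<open>C\<close> is compact, so a fibre covered by the union would already
  be covered by a single member.\<close>

lemma minimal_closed_preimage:
  assumes X: "compact_space X" and Y: "t1_space Y" and g: "continuous_map X Y g"
    and CY: "C \<subseteq> g ` topspace X"
  obtains M where "closedin X M" "C \<subseteq> g ` M"
    "\<And>N. closedin X N \<Longrightarrow> C \<subseteq> g ` N \<Longrightarrow> N \<subseteq> M \<Longrightarrow> N = M"
proof -
  let ?A = "{W. openin X W \<and> C \<subseteq> g ` (topspace X - W)}"
  have "\<exists>W\<in>?A. \<forall>V\<in>?A. W \<subseteq> V \<longrightarrow> V = W"
  proof (rule subset_Zorn_nonempty)
    show "?A \<noteq> {}" using CY by (auto intro!: exI[of _ "{}"])
    fix \<C> assume ne: "\<C> \<noteq> {}" and ch: "subset.chain ?A \<C>"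
    have op: "\<And>W. W \<in> \<C> \<Longrightarrow> openin X W \<and> C \<subseteq> g ` (topspace X - W)"
      using ch by (auto simp: subset.chain_def)
    have "y \<in> g ` (topspace X - \<Union>\<C>)" if y: "y \<in> C" for y
    proof (rule ccontr)
      assume c: "y \<notin> g ` (topspace X - \<Union>\<C>)"
      let ?F = "{x \<in> topspace X. g x \<in> {y}}"
      have "y \<in> topspace Y" using y CY g by (auto simp: continuous_map_def)
      then have "closedin Y {y}" using Y by (simp add: t1_space_closedin_singleton)
      from closedin_continuous_map_preimage[OF g this]
      have "compactin X ?F" by (rule closedin_compact_space[OF X])
      moreover have "?F \<subseteq> \<Union>\<C>" using c by auto
      ultimately have "\<exists>\<F>. finite \<F> \<and> \<F> \<subseteq> \<C> \<and> ?F \<subseteq> \<Union>\<F>"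
        using op by (intro compactinD) auto
      then obtain \<F> where \<F>: "finite \<F>" "\<F> \<subseteq> \<C>" "?F \<subseteq> \<Union>\<F>"
        by blast
      have "\<exists>W\<in>\<C>. \<Union>\<F> \<subseteq> W"
      proof (cases "\<F> = {}")
        case False
        have "\<forall>U\<in>\<C>. \<forall>V\<in>\<C>. U \<subseteq> V \<or> V \<subseteq> U" using ch by (simp add: subset_chain_def)
        then have "\<forall>U\<in>\<F>. \<forall>V\<in>\<F>. U \<subseteq> V \<or> V \<subseteq> U" using \<F>(2) by (meson subsetD)
        then have "subset.chain UNIV \<F>" by (simp add: subset_chain_def)
        then have "\<Union>\<F> \<in> \<F>" by (rule Union_in_chain[OF \<F>(1) False])
        then show ?thesis using \<F>(2) by (intro bexI[of _ "\<Union>\<F>"]) auto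
      qed (use ne in auto)
      then obtain W where W: "W \<in> \<C>" "\<Union>\<F> \<subseteq> W" by (elim bexE)
      have "?F \<subseteq> W" using \<F>(3) W(2) by (rule subset_trans)
      moreover obtain x where "x \<in> topspace X - W" "g x = y" using op[OF W(1)] y by blast
      ultimately show False by blast
    qed
    then show "\<Union>\<C> \<in> ?A" using op by blast
  qed
  then obtain W where W': "W \<in> ?A" "\<And>V. V \<in> ?A \<Longrightarrow> W \<subseteq> V \<Longrightarrow> V = W"
    by (elim bexE) simp
  then have W: "openin X W" "C \<subseteq> g ` (topspace X - W)"
    "\<And>V. openin X V \<Longrightarrow> C \<subseteq> g ` (topspace X - V) \<Longrightarrow> W \<subseteq> V \<Longrightarrow> V = W"
    by (simp_all only: mem_Collect_eq)
  show thesis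
  proof (rule that[of "topspace X - W"])
    fix N assume N: "closedin X N" "C \<subseteq> g ` N" "N \<subseteq> topspace X - W"
    have "topspace X - (topspace X - N) = N" using closedin_subset[OF N(1)] by blast
    moreover have "topspace X - N = W"
      using N openin_subset[OF W(1)] calculation by (intro W(3)) auto
    ultimately show "N = topspace X - W" by simp
  qed (use W in auto)
qed

text \<open>The image of a relatively open set need not be open, so \<open>C\<close> is lifted to a
  minimal closed \<open>M\<close> whose image covers it. Removing a small open piece
  \<open>V\<close> from \<open>M\<close> uncovers part of \<open>C\<close>; the uncovered part is
  open in \<open>C\<close>, and its preimages in \<open>M\<close> lie in \<open>V\<close>.\<close>

lemma fragments_image:
  assumes X: "compact_space X" and Y: "Hausdorff_space Y" and g: "continuous_map X Y g"
    and surj: "g ` topspace X = topspace Y" and fr: "fragments X d"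
    and uc: "\<And>\<epsilon>. \<epsilon> > 0 \<Longrightarrow> \<exists>\<delta>>0. \<forall>x\<in>topspace X. \<forall>y\<in>topspace X. d x y \<le> \<delta> \<longrightarrow> e (g x) (g y) \<le> \<epsilon>"
  shows "fragments Y e"
  unfolding fragments_iff
proof (intro allI impI)
  fix \<epsilon> :: real and C
  assume e: "\<epsilon> > 0" and C: "closedin Y C \<and> C \<noteq> {}"
  obtain \<delta> where \<delta>: "\<delta> > 0"
    "\<And>x y. x \<in> topspace X \<Longrightarrow> y \<in> topspace X \<Longrightarrow> d x y \<le> \<delta> \<Longrightarrow> e (g x) (g y) \<le> \<epsilon>"
    using uc[OF e] by blast
  have "C \<subseteq> g ` topspace X" using surj C closedin_subset by blast
  with X g Hausdorff_imp_t1_space[OF Y] obtain M where M: "closedin X M" "C \<subseteq> g ` M"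
    and min: "\<And>N. closedin X N \<Longrightarrow> C \<subseteq> g ` N \<Longrightarrow> N \<subseteq> M \<Longrightarrow> N = M"
    using minimal_closed_preimage[of X Y g C] by metis
  have "M \<noteq> {}" using M C by auto
  then obtain V where V: "openin (subtopology X M) V" "V \<noteq> {}" "\<forall>x\<in>V. \<forall>y\<in>V. d x y \<le> \<delta>"
    using fr[unfolded fragments_iff, rule_format, of \<delta> M] \<delta>(1) M(1) by auto
  have VM: "V \<subseteq> M" using openin_subset[OF V(1)] by simp
  obtain T where T: "openin X T" "V = T \<inter> M" using V(1) by (auto simp: openin_subtopology)
  have "M - V = M - T" using T(2) by blast
  then have cl: "closedin X (M - V)" using M(1) T(1) by (simp add: closedin_diff)
  let ?U = "C - g ` (M - V)"
  have "compactin Y (g ` (M - V))"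
    using cl X g by (blast intro: image_compactin closedin_compact_space)
  then have "openin (subtopology Y C) ?U"
    using Y C compactin_imp_closedin
    by (metis closedin_subset openin_subtopology_diff_closed)
  moreover have "?U \<noteq> {}"
  proof
    assume "?U = {}"
    then have "M - V = M" using min[OF cl] by blast
    then show False using VM V(2) by blast
  qed
  moreover have "e x y \<le> \<epsilon>" if xy: "x \<in> ?U" "y \<in> ?U" for x y
  proof -
    obtain x' y' where "x = g x'" "y = g y'" "x' \<in> V" "y' \<in> V"
      using xy M(2) by blast
    moreover have "V \<subseteq> topspace X" using VM M(1) closedin_subset by blast
    ultimately show ?thesis using \<delta>(2) V(3) by blast
  qed
  ultimately show "\<exists>U. openin (subtopology Y C) U \<and> U \<noteq> {} \<and> (\<forall>x\<in>U. \<forall>y\<in>U. e x y \<le> \<epsilon>)"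
    by blast
qed

text \<open>Each further distance shrinks the open piece found so far. As that piece need not be
  closed, fragmentation is applied to its closure, in which it is dense.\<close>

lemma fragments_finite_common:
  assumes "finite F" and fr: "\<And>i. i \<in> F \<Longrightarrow> fragments X (d i)"
    and e: "\<epsilon> > 0" and L: "closedin X L" "L \<noteq> {}"
  shows "\<exists>U. openin (subtopology X L) U \<and> U \<noteq> {} \<and> (\<forall>i\<in>F. \<forall>x\<in>U. \<forall>y\<in>U. d i x y \<le> \<epsilon>)"
  using assms(1) fr
proof (induction F rule: finite_induct)
  case empty
  have "topspace (subtopology X L) = L" using closedin_subset[OF L(1)] by auto
  then have "openin (subtopology X L) L" by (metis openin_topspace)
  then show ?case using L(2) by (intro exI[of _ L]) simp
next
  case (insert i F)
  then obtain U where U: "openin (subtopology X L) U" "U \<noteq> {}"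
    "\<forall>i\<in>F. \<forall>x\<in>U. \<forall>y\<in>U. d i x y \<le> \<epsilon>" by auto
  obtain T where T: "openin X T" "U = T \<inter> L" using U(1) by (auto simp: openin_subtopology)
  have UX: "U \<subseteq> topspace X" using T openin_subset by blast
  have UC: "U \<subseteq> X closure_of U" using UX by (rule closure_of_subset)
  have CL: "X closure_of U \<subseteq> L" using L(1) T by (intro closure_of_minimal) auto
  obtain V where V: "openin (subtopology X (X closure_of U)) V" "V \<noteq> {}"
    "\<forall>x\<in>V. \<forall>y\<in>V. d i x y \<le> \<epsilon>"
    using insert.prems[of i, unfolded fragments_iff, rule_format, of \<epsilon> "X closure_of U"] e U(2) UC
    by auto
  obtain S where S: "openin X S" "V = S \<inter> X closure_of U" using V(1) by (auto simp: openin_subtopology)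
  have "S \<inter> U \<noteq> {}" using S V(2) openin_Int_closure_of_eq_empty by blast
  moreover have "S \<inter> U = (S \<inter> T) \<inter> L" using T by auto
  then have "openin (subtopology X L) (S \<inter> U)"
    using S(1) T(1) by (auto simp: openin_subtopology)
  moreover have "\<forall>j\<in>insert i F. \<forall>x\<in>S \<inter> U. \<forall>y\<in>S \<inter> U. d j x y \<le> \<epsilon>"
    using U(3) V(3) S(2) UC by auto
  ultimately show ?case by blast
qed

lemma fragments_countable_sup:
  assumes fr: "\<And>i. i \<in> I \<Longrightarrow> fragments X (d i)"
    and tail: "\<And>\<epsilon>. \<epsilon> > 0 \<Longrightarrow> \<exists>F\<subseteq>I. finite F \<and> (\<forall>x\<in>topspace X. \<forall>y\<in>topspace X.
      (\<forall>i\<in>F. d i x y \<le> \<epsilon>) \<longrightarrow> e x y \<le> \<epsilon>)"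
  shows "fragments X e"
  unfolding fragments_iff
proof (intro allI impI)
  fix \<epsilon> :: real and L
  assume e: "\<epsilon> > 0" and L: "closedin X L \<and> L \<noteq> {}"
  obtain F where F: "F \<subseteq> I" "finite F" "\<And>x y. x \<in> topspace X \<Longrightarrow> y \<in> topspace X \<Longrightarrow>
      (\<forall>i\<in>F. d i x y \<le> \<epsilon>) \<Longrightarrow> e x y \<le> \<epsilon>"
    using tail[OF e] by blast
  obtain U where U: "openin (subtopology X L) U" "U \<noteq> {}" "\<forall>i\<in>F. \<forall>x\<in>U. \<forall>y\<in>U. d i x y \<le> \<epsilon>"
    using fragments_finite_common[of F X d \<epsilon> L] F fr e L by blast
  have "U \<subseteq> topspace X" using openin_subset[OF U(1)] by simp
  then show "\<exists>U. openin (subtopology X L) U \<and> U \<noteq> {} \<and> (\<forall>x\<in>U. \<forall>y\<in>U. e x y \<le> \<epsilon>)"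
    using U F(3) by (intro exI[of _ U]) blast
qed

section \<open>Lower semicontinuous metrics on compact spaces\<close>

text \<open>Open, closed and closure always refer to the compact topology \<open>X\<close>; the
  metric \<open>d\<close> is tied to it only by lower semicontinuity and need not induce it.\<close>

locale lsc_compact_metric = Metric_space "topspace X" d for X :: "'a topology" and d +
  assumes compact: "compact_space X" and Hausdorff: "Hausdorff_space X"
    and lsc: "lower_semicontinuous_map (prod_topology X X) (\<lambda>(x, y). d x y)"
begin

lemma normal: "normal_space X"
  using compact Hausdorff by (simp add: compact_Hausdorff_or_regular_imp_normal_space)

text \<open>By lower semicontinuity the pairs at distance at most \<open>r\<close> form a closed
  subset of the product, and projection along a compact factor is a closed map.\<close>

lemma closedin_neighbourhood:
  assumes A: "closedin X A"
  shows "closedin X {x \<in> topspace X. \<exists>y\<in>A. d x y \<le> r}"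
proof -
  let ?P = "prod_topology X X"
  have "openin ?P {z \<in> topspace ?P. r < (\<lambda>(x, y). d x y) z}"
    using lsc by (simp add: lower_semicontinuous_map_def)
  then have "closedin ?P (topspace ?P - {z \<in> topspace ?P. r < (\<lambda>(x, y). d x y) z})"
    by blast
  moreover have "closedin ?P (topspace X \<times> A)" using A by (simp add: closedin_prod_Times_iff)
  ultimately have "closedin ?P ((topspace ?P - {z \<in> topspace ?P. r < (\<lambda>(x, y). d x y) z}) \<inter> (topspace X \<times> A))"
    by (rule closedin_Int)
  then have "closedin X (fst ` ((topspace ?P - {z \<in> topspace ?P. r < (\<lambda>(x, y). d x y) z}) \<inter> (topspace X \<times> A)))"
    using closed_map_fst[OF compact] by (auto simp: closed_map_def)
  moreover have "fst ` ((topspace ?P - {z \<in> topspace ?P. r < (\<lambda>(x, y). d x y) z}) \<inter> (topspace X \<times> A))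
      = {x \<in> topspace X. \<exists>y\<in>A. d x y \<le> r}"
    using closedin_subset[OF A] by force
  ultimately show ?thesis by simp
qed

text \<open>The closed \<open>r\<close>-neighbourhoods of \<open>A\<close> and \<open>B\<close> are
  disjoint by the triangle inequality, so normality separates them; the open set around that of
  \<open>B\<close> misses \<open>V\<close> and therefore also the closure of
  \<open>V\<close>.\<close>

lemma interpolation:
  assumes A: "closedin X A" and B: "closedin X B"
    and AB: "\<And>a b. a \<in> A \<Longrightarrow> b \<in> B \<Longrightarrow> 2 * r < d a b"
  shows "\<exists>V. openin X V \<and> (\<forall>a\<in>A. \<forall>y\<in>topspace X - V. r < d a y) \<and>
    (\<forall>x\<in>X closure_of V. \<forall>b\<in>B. r < d x b)"
proof -
  let ?A = "{x \<in> topspace X. \<exists>y\<in>A. d x y \<le> r}"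
  let ?B = "{x \<in> topspace X. \<exists>y\<in>B. d x y \<le> r}"
  have AX: "A \<subseteq> topspace X" and BX: "B \<subseteq> topspace X" using A B closedin_subset by auto
  have "disjnt ?A ?B"
    unfolding disjnt_iff
  proof safe
    fix x a b assume H: "x \<in> topspace X" "a \<in> A" "d x a \<le> r" "b \<in> B" "d x b \<le> r"
    then have "d a b \<le> d a x + d x b" using AX BX by (intro triangle) auto
    then show False using AB[OF H(2,4)] H commute[of a x] by linarith
  qed
  then have "\<exists>V W. openin X V \<and> openin X W \<and> ?A \<subseteq> V \<and> ?B \<subseteq> W \<and> disjnt V W"
    using closedin_neighbourhood[OF A, of r] closedin_neighbourhood[OF B, of r]
    by (intro normal[unfolded normal_space_def, rule_format]) simp
  then obtain V W where VW: "openin X V" "openin X W" "?A \<subseteq> V" "?B \<subseteq> W" "disjnt V W"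
    by (elim exE conjE)
  have "W \<inter> X closure_of V = {}"
    using VW openin_Int_closure_of_eq_empty[OF VW(2)] by (auto simp: disjnt_iff)
  have "r < d x b" if "x \<in> X closure_of V" "b \<in> B" for x b
  proof (rule ccontr)
    assume "\<not> r < d x b"
    then have "d x b \<le> r" by simp
    moreover have "x \<in> topspace X" using that(1) by (simp add: in_closure_of)
    ultimately have "x \<in> ?B" using that(2) by blast
    then show False using VW(4) that \<open>W \<inter> X closure_of V = {}\<close> by blast
  qed
  moreover have "r < d a y" if "a \<in> A" "y \<in> topspace X - V" for a y
  proof (rule ccontr)
    assume "\<not> r < d a y"
    then have "d y a \<le> r" by (simp add: commute)
    then have "y \<in> ?A" using that by blast
    then show False using VW(3) that by blast
  qed
  ultimately show ?thesis using VW(1) by blast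
qed

text \<open>The values of a staircase \<open>k\<close> are levels of an approximate scale function: points at distance
  at most \<open>r\<close> lie on levels differing by at most one. The closure provides the room needed to
  insert a level between any two by normality, which halves \<open>r\<close> and doubles \<open>k\<close>, so that
  \<open>k / 2 ^ n\<close> converges to a continuous function.\<close>

definition staircase :: "real \<Rightarrow> ('a \<Rightarrow> nat) \<Rightarrow> bool" where
  "staircase r k \<longleftrightarrow> (\<forall>j. openin X {x \<in> topspace X. k x \<le> j}) \<and>
     (\<forall>j. \<forall>x \<in> X closure_of {x \<in> topspace X. k x \<le> j}. \<forall>y \<in> topspace X. Suc j < k y \<longrightarrow> r < d x y)"

text \<open>The sublevel sets of \<open>k\<close> are kept at the even levels of \<open>k'\<close>;
  \<open>interpolation\<close> inserts an open set between two consecutive ones at each odd level,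
  at the price of halving the distance.\<close>

lemma staircase_refine:
  assumes r: "r \<ge> 0" and k: "staircase (2 * r) k"
  shows "\<exists>k'. staircase r k' \<and> (\<forall>x. k' x = 2 * k x \<or> Suc (k' x) = 2 * k x)"
proof -
  let ?A = "\<lambda>j. {x \<in> topspace X. k x \<le> j}"
  have op: "openin X (?A j)" for j using k by (simp add: staircase_def)
  have cl: "closedin X {x \<in> topspace X. Suc j < k x}" for j
  proof -
    have "topspace X - ?A (Suc j) = {x \<in> topspace X. Suc j < k x}" by auto
    then show ?thesis using op[of "Suc j"] by (metis closedin_diff closedin_topspace)
  qed
  have "\<forall>j. \<exists>V. openin X V \<and> (\<forall>a\<in>X closure_of ?A j. \<forall>y\<in>topspace X - V. r < d a y) \<and>
    (\<forall>x\<in>X closure_of V. \<forall>b\<in>{x \<in> topspace X. Suc j < k x}. r < d x b)"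
    by (intro allI interpolation) (use k cl in \<open>auto simp: staircase_def\<close>)
  then obtain V where "\<forall>j. openin X (V j) \<and>
    (\<forall>a\<in>X closure_of ?A j. \<forall>y\<in>topspace X - V j. r < d a y) \<and>
    (\<forall>x\<in>X closure_of V j. \<forall>b\<in>{x \<in> topspace X. Suc j < k x}. r < d x b)"
    by (elim choice[THEN exE])
  then have V: "\<And>j. openin X (V j)"
    "\<And>j a y. a \<in> X closure_of ?A j \<Longrightarrow> y \<in> topspace X - V j \<Longrightarrow> r < d a y"
    "\<And>j x b. x \<in> X closure_of V j \<Longrightarrow> b \<in> topspace X \<Longrightarrow> Suc j < k b \<Longrightarrow> r < d x b"
    by simp_all
  \<comment> \<open>A point of \<open>?A j\<close> outside \<open>V j\<close> would be at distance
    more than \<open>r\<close> from itself.\<close>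
  have AV: "?A j \<subseteq> V j" for j
  proof
    fix x assume x: "x \<in> ?A j"
    moreover have "?A j \<subseteq> X closure_of ?A j" by (rule closure_of_subset) auto
    ultimately have "x \<in> X closure_of ?A j" by (rule rev_subsetD)
    then show "x \<in> V j" using V(2)[of x j x] x r by force
  qed
  have VA: "V j \<subseteq> ?A (Suc j)" for j
  proof
    fix x assume x: "x \<in> V j"
    then have xX: "x \<in> topspace X" using openin_subset[OF V(1)] by (rule rev_subsetD)
    have "V j \<subseteq> X closure_of V j" by (intro closure_of_subset openin_subset V(1))
    then have "x \<in> X closure_of V j" using x by (rule subsetD)
    then show "x \<in> ?A (Suc j)" using V(3)[of x j x] xX r by force
  qed
  \<comment> \<open>Chosen so that the sublevel set of \<open>k'\<close> at \<open>2 * j\<close> is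
    \<open>?A j\<close> and the one at \<open>Suc (2 * j)\<close> is \<open>V j\<close>.\<close>
  define k' where "k' x = (if k x = 0 then 0 else if x \<in> V (k x - 1) then 2 * k x - 1 else 2 * k x)" for x
  have even: "{x \<in> topspace X. k' x \<le> 2 * j} = ?A j" for j
    by (auto simp: k'_def split: if_splits)
  have odd: "{x \<in> topspace X. k' x \<le> Suc (2 * j)} = V j" for j
  proof (intro set_eqI iffI)
    fix x assume x: "x \<in> {x \<in> topspace X. k' x \<le> Suc (2 * j)}"
    show "x \<in> V j"
    proof (cases "k x \<le> j")
      case True then show ?thesis using AV x by blast
    next
      case False
      then have "k x = Suc j" "x \<in> V (k x - 1)" using x by (auto simp: k'_def split: if_splits)
      then show ?thesis by simp
    qed
  next
    fix x assume x: "x \<in> V j"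
    then have "x \<in> topspace X" "k x \<le> Suc j" using VA by auto
    then show "x \<in> {x \<in> topspace X. k' x \<le> Suc (2 * j)}"
      using x by (cases "k x = Suc j") (auto simp: k'_def)
  qed
  have gt: "Suc j < k x" if "Suc (Suc (2 * j)) < k' x" for j x
    using that by (auto simp: k'_def split: if_splits)
  have "staircase r k'"
    unfolding staircase_def
  proof (intro conjI allI ballI impI)
    fix j show "openin X {x \<in> topspace X. k' x \<le> j}"
      by (cases "even j") (auto elim!: evenE oddE simp: even odd op V(1))
  next
    fix j x y
    assume x: "x \<in> X closure_of {x \<in> topspace X. k' x \<le> j}" and y: "y \<in> topspace X"
      and j: "Suc j < k' y"
    show "r < d x y"
    proof (cases "even j")
      case True
      then obtain i where i: "j = 2 * i" by blast
      have "y \<notin> V i" using j i unfolding odd[of i, symmetric] by simp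
      then show ?thesis using V(2) x y i even[of i] by auto
    next
      case False
      then obtain i where i: "j = Suc (2 * i)" by (metis oddE Suc_eq_plus1)
      then have "Suc i < k y" using gt j by blast
      then show ?thesis using V(3) x y i odd[of i] by auto
    qed
  qed
  then show ?thesis by (intro exI[of _ k']) (auto simp: k'_def)
qed

text \<open>Repeated refinement gives staircases \<open>k n\<close> for \<open>r / 2 ^ n\<close>. As
  \<open>k n / 2 ^ n\<close> decreases and \<open>(k n - 1) / 2 ^ n\<close> increases in
  \<open>n\<close>, the limit \<open>h\<close> lies between them at every stage, so adjacent levels
  at stage \<open>n\<close> mean values of \<open>h\<close> within \<open>2 / 2 ^ n\<close>.\<close>

lemma staircase_limit:
  assumes r: "r > 0" and k0: "staircase r k0"
  obtains h where "continuous_map X euclideanreal h"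
    "\<And>x. real (k0 x) - 1 \<le> h x" "\<And>x. h x \<le> real (k0 x)"
    "\<And>n x y. x \<in> topspace X \<Longrightarrow> y \<in> topspace X \<Longrightarrow> d x y \<le> r / 2 ^ n \<Longrightarrow> \<bar>h x - h y\<bar> \<le> 2 / 2 ^ n"
proof -
  have "\<exists>k. \<forall>n. (staircase (r / 2 ^ n) (k n) \<and> (n = 0 \<longrightarrow> k n = k0)) \<and>
    (\<forall>x. k (Suc n) x = 2 * k n x \<or> Suc (k (Suc n) x) = 2 * k n x)"
  proof (rule dependent_nat_choice)
    show "\<exists>k. staircase (r / 2 ^ 0) k \<and> (0 = (0 :: nat) \<longrightarrow> k = k0)" using k0 by simp
    fix k n assume "staircase (r / 2 ^ n) k \<and> (n = 0 \<longrightarrow> k = k0)"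
    then have "staircase (2 * (r / 2 ^ Suc n)) k" by simp
    then show "\<exists>k'. (staircase (r / 2 ^ Suc n) k' \<and> (Suc n = 0 \<longrightarrow> k' = k0)) \<and>
        (\<forall>x. k' x = 2 * k x \<or> Suc (k' x) = 2 * k x)"
      using staircase_refine[of "r / 2 ^ Suc n" k] r by auto
  qed
  then obtain k where k: "\<And>n. staircase (r / 2 ^ n) (k n)" "k 0 = k0"
    "\<And>n x. k (Suc n) x = 2 * k n x \<or> Suc (k (Suc n) x) = 2 * k n x" by metis
  define H where "H n x = real (k n x) / 2 ^ n" for n x
  define h where "h x = (INF n. H n x)" for x
  have kk: "real (k (Suc n) x) \<le> 2 * real (k n x)" "2 * real (k n x) \<le> real (k (Suc n) x) + 1" for n x
    using k(3)[of n x] by auto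
  have dec: "decseq (\<lambda>n. H n x)" for x
    unfolding decseq_Suc_iff H_def using kk(1) by (simp add: field_simps)
  have inc: "incseq (\<lambda>n. H n x - 1 / 2 ^ n)" for x
    unfolding incseq_Suc_iff H_def
  proof
    fix n
    have "(real (k n x) - 1) / 2 ^ n \<le> (real (k (Suc n) x) - 1) / 2 ^ Suc n"
      using divide_right_mono[OF kk(2)[of n x], of "2 ^ Suc n"] by (simp add: diff_divide_distrib add_divide_distrib)
    then show "real (k n x) / 2 ^ n - 1 / 2 ^ n \<le> real (k (Suc n) x) / 2 ^ Suc n - 1 / 2 ^ Suc n"
      by (simp add: diff_divide_distrib)
  qed
  have upper: "h x \<le> H n x" for n x
    unfolding h_def by (rule cINF_lower) (auto intro!: bdd_belowI[of _ 0] simp: H_def)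
  have lower: "H n x - 1 / 2 ^ n \<le> h x" for n x
    unfolding h_def
  proof (rule cINF_greatest)
    fix m
    have "H n x - 1 / 2 ^ n \<le> H (max n m) x - 1 / 2 ^ max n m"
      using inc[of x] by (auto simp: incseq_def)
    also have "\<dots> \<le> H (max n m) x" by simp
    also have "\<dots> \<le> H m x" using dec[of x] by (auto simp: decseq_def)
    finally show "H n x - 1 / 2 ^ n \<le> H m x" .
  qed simp
  have close: "\<bar>h x - h y\<bar> \<le> 2 / 2 ^ n" if "k n x \<le> Suc (k n y)" "k n y \<le> Suc (k n x)" for n x y
  proof -
    have "H n x \<le> H n y + 1 / 2 ^ n" "H n y \<le> H n x + 1 / 2 ^ n"
      using that unfolding H_def by (auto simp flip: add_divide_distrib intro!: divide_right_mono)
    moreover have "2 / 2 ^ n = 1 / 2 ^ n + 1 / (2 ^ n :: real)" by simp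
    ultimately show ?thesis using upper[of x n] upper[of y n] lower[of n x] lower[of n y] by linarith
  qed
  have gap: "k n y \<le> Suc (k n x)" if "x \<in> topspace X" "y \<in> topspace X" "d x y \<le> r / 2 ^ n" for n x y
  proof (rule ccontr)
    let ?S = "{z \<in> topspace X. k n z \<le> k n x}"
    assume "\<not> k n y \<le> Suc (k n x)"
    moreover have "?S \<subseteq> X closure_of ?S" by (rule closure_of_subset) auto
    then have "x \<in> X closure_of ?S" using that(1) by blast
    ultimately have "r / 2 ^ n < d x y" using k(1)[of n] that(2) unfolding staircase_def by auto
    then show False using that(3) by simp
  qed
  have "continuous_map X Met_TC.mtopology h"
    unfolding Met_TC.continuous_map_to_metric
  proof (intro ballI allI impI)
    fix x and \<epsilon> :: real assume x: "x \<in> topspace X" and "\<epsilon> > 0"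
    then obtain n where "(1 / 2) ^ n < \<epsilon> / 2" using real_arch_pow_inv[of "\<epsilon> / 2" "1 / 2"] by auto
    then have n: "2 / 2 ^ n < \<epsilon>" by (simp add: power_divide)
    let ?U = "\<lambda>j. {z \<in> topspace X. k n z \<le> j}"
    \<comment> \<open>A neighbourhood of \<open>x\<close> on which \<open>k n\<close> is at most
      \<open>k n x\<close> and at least \<open>k n x - 1\<close>; for \<open>k n x < 2\<close>
      nothing has to be cut off below. The staircase property keeps \<open>x\<close> out of the
      removed closure, as \<open>d x x = 0\<close>.\<close>
    let ?V = "if k n x < 2 then ?U (k n x) else ?U (k n x) - X closure_of (?U (k n x - 2))"
    have op: "openin X (?U j)" for j using k(1)[of n] by (simp add: staircase_def)
    have "x \<notin> X closure_of (?U (k n x - 2))" if "\<not> k n x < 2"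
    proof
      assume "x \<in> X closure_of (?U (k n x - 2))"
      moreover have "Suc (k n x - 2) < k n x" using that by simp
      ultimately have "r / 2 ^ n < d x x" using k(1)[of n] x unfolding staircase_def by blast
      moreover have "0 < r / 2 ^ n" using r by simp
      ultimately show False using x by simp
    qed
    then have "x \<in> ?V" using x by simp
    moreover have "openin X ?V" using op by (simp add: openin_diff)
    moreover have "h y \<in> Met_TC.mball (h x) \<epsilon>" if y: "y \<in> ?V" for y
    proof -
      have le: "k n y \<le> k n x" using y by (simp split: if_splits)
      have "k n x \<le> Suc (k n y)"
      proof (rule ccontr)
        assume c: "\<not> k n x \<le> Suc (k n y)"
        then have "\<not> k n x < 2" by simp
        then have "y \<notin> X closure_of (?U (k n x - 2))" "y \<in> topspace X" using y by auto
        moreover have "?U (k n x - 2) \<subseteq> X closure_of (?U (k n x - 2))"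
          by (rule closure_of_subset) auto
        ultimately have "\<not> k n y \<le> k n x - 2" by blast
        then show False using c by simp
      qed
      then have "\<bar>h x - h y\<bar> < \<epsilon>" using close[of n x y] le n by simp
      then show ?thesis by (simp add: dist_real_def)
    qed
    ultimately show "\<exists>U. openin X U \<and> x \<in> U \<and> (\<forall>y\<in>U. h y \<in> Met_TC.mball (h x) \<epsilon>)"
      by (intro exI[of _ ?V] conjI ballI)
  qed
  then have cont: "continuous_map X euclideanreal h" by simp
  show thesis
  proof (rule that[OF cont])
    show "real (k0 x) - 1 \<le> h x" "h x \<le> real (k0 x)" for x
      using upper[of x 0] lower[of 0 x] k(2) by (simp_all add: H_def)
    show "\<bar>h x - h y\<bar> \<le> 2 / 2 ^ n"
      if "x \<in> topspace X" "y \<in> topspace X" "d x y \<le> r / 2 ^ n" for n x y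
      using close[of n x y] gap[OF that] gap[OF that(2,1)] that(3) by (simp add: commute)
  qed
qed

text \<open>The pairs at distance at most \<open>1 / Suc m\<close> whose values differ by at least
  \<epsilon> form a decreasing sequence of closed sets in a compact product. If none were empty, a
  common pair would have distance \<open>0\<close> but distinct values.\<close>

lemma continuous_map_uniform:
  assumes f: "continuous_map X euclideanreal f" and e: "\<epsilon> > 0"
  shows "\<exists>m::nat. \<forall>x\<in>topspace X. \<forall>y\<in>topspace X. d x y \<le> 1 / Suc m \<longrightarrow> \<bar>f x - f y\<bar> < \<epsilon>"
proof (rule ccontr)
  assume neg: "\<not> ?thesis"
  let ?P = "prod_topology X X"
  define C where "C m = (topspace ?P - {z \<in> topspace ?P. 1 / Suc m < (\<lambda>(x, y). d x y) z}) \<inter>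
    {z \<in> topspace ?P. \<bar>f (fst z) - f (snd z)\<bar> \<in> {\<epsilon>..}}" for m :: nat
  have C: "C m = {(x, y). x \<in> topspace X \<and> y \<in> topspace X \<and> d x y \<le> 1 / Suc m \<and> \<epsilon> \<le> \<bar>f x - f y\<bar>}" for m
    by (auto simp: C_def)
  have "continuous_map ?P euclideanreal (\<lambda>z. f (fst z))" "continuous_map ?P euclideanreal (\<lambda>z. f (snd z))"
    using f continuous_map_compose[OF continuous_map_fst f] continuous_map_compose[OF continuous_map_snd f]
    by (simp_all add: o_def)
  then have "continuous_map ?P euclideanreal (\<lambda>z. \<bar>f (fst z) - f (snd z)\<bar>)"
    by (intro continuous_map_real_abs continuous_map_diff)
  then have clf: "closedin ?P {z \<in> topspace ?P. \<bar>f (fst z) - f (snd z)\<bar> \<in> {\<epsilon>..}}"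
    by (rule closedin_continuous_map_preimage) simp
  have "closedin ?P (C m)" for m
    unfolding C_def using lsc unfolding lower_semicontinuous_map_def
    by (intro closedin_Int closedin_diff closedin_topspace clf) blast
  moreover have "C m \<noteq> {}" for m using neg unfolding C by fastforce
  moreover have "decseq C"
  proof (unfold decseq_Suc_iff, intro allI subsetI)
    fix n z assume z: "z \<in> C (Suc n)"
    have "1 / real (Suc (Suc n)) \<le> 1 / Suc n" by (simp add: field_simps)
    then show "z \<in> C n" using z unfolding C by auto
  qed
  moreover have "compact_space ?P" using compact by (simp add: compact_space_prod_topology)
  ultimately have "(\<Inter>n. C n) \<noteq> {}" by (intro compact_space_imp_nest)
  then obtain x y where xy: "\<And>n. (x, y) \<in> C n" by auto
  then have X: "x \<in> topspace X" "y \<in> topspace X" "\<epsilon> \<le> \<bar>f x - f y\<bar>" and dn: "\<And>n. d x y \<le> 1 / Suc n"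
    unfolding C by auto
  have "d x y \<le> 0"
  proof (rule ccontr)
    assume "\<not> d x y \<le> 0"
    then obtain n where "1 / real (Suc n) < d x y" using nat_approx_posE by (metis not_le)
    then show False using dn[of n] by simp
  qed
  then have "d x y = 0" using nonneg[of x y] by simp
  then have "x = y" using X by simp
  then show False using X(3) e by simp
qed

text \<open>The point is that the modulus of continuity of \<open>g\<close> depends only on
  \<open>m\<close> and \<epsilon>. Rounding \<open>f\<close> to multiples of \<epsilon> gives a
  staircase, and \<open>g\<close> is its rescaled limit.\<close>

lemma uniform_approximation:
  assumes f: "continuous_map X euclideanreal f" and ab: "a \<le> b"
    and fab: "\<And>x. x \<in> topspace X \<Longrightarrow> f x \<in> {a..b}" and e: "\<epsilon> > 0"
  obtains m :: nat and g where "continuous_map X (top_of_set {a..b}) g"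
    "\<And>x. x \<in> topspace X \<Longrightarrow> \<bar>f x - g x\<bar> \<le> \<epsilon>"
    "\<And>n x y. x \<in> topspace X \<Longrightarrow> y \<in> topspace X \<Longrightarrow> d x y \<le> 1 / Suc m / 2 ^ n \<Longrightarrow>
       \<bar>g x - g y\<bar> \<le> \<epsilon> * (2 / 2 ^ n)"
proof -
  obtain m :: nat where m: "\<And>x y. x \<in> topspace X \<Longrightarrow> y \<in> topspace X \<Longrightarrow> d x y \<le> 1 / Suc m \<Longrightarrow> \<bar>f x - f y\<bar> < \<epsilon>"
    using continuous_map_uniform[OF f e] by blast
  \<comment> \<open>The extra \<open>1\<close> makes the sublevel set at \<open>j\<close> the open
    set where \<open>f x < a + j * \<epsilon>\<close>.\<close>
  define k where "k x = nat (\<lfloor>(f x - a) / \<epsilon>\<rfloor> + 1)" for x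
  have k_le: "k x \<le> j \<longleftrightarrow> f x < a + j * \<epsilon>" if "x \<in> topspace X" for x j
  proof -
    have "0 \<le> \<lfloor>(f x - a) / \<epsilon>\<rfloor>" using fab[OF that] e by simp
    then have "k x \<le> j \<longleftrightarrow> \<lfloor>(f x - a) / \<epsilon>\<rfloor> < int j" unfolding k_def by linarith
    also have "\<dots> \<longleftrightarrow> (f x - a) / \<epsilon> < j" by (simp add: floor_less_iff)
    also have "\<dots> \<longleftrightarrow> f x < a + j * \<epsilon>" using e by (simp add: field_simps)
    finally show ?thesis .
  qed
  have S: "{x \<in> topspace X. k x \<le> j} = {x \<in> topspace X. f x \<in> {..<a + j * \<epsilon>}}" for j
    using k_le by auto
  have "staircase (1 / Suc m) k"
    unfolding staircase_def
  proof (intro conjI allI ballI impI)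
    fix j
    show "openin X {x \<in> topspace X. k x \<le> j}"
      unfolding S by (rule openin_continuous_map_preimage[OF f]) simp
    fix x y assume x: "x \<in> X closure_of {x \<in> topspace X. k x \<le> j}" and y: "y \<in> topspace X"
      and j: "Suc j < k y"
    have "closedin X {x \<in> topspace X. f x \<in> {..a + j * \<epsilon>}}"
      by (rule closedin_continuous_map_preimage[OF f]) simp
    then have "X closure_of {x \<in> topspace X. k x \<le> j} \<subseteq> {x \<in> topspace X. f x \<in> {..a + j * \<epsilon>}}"
      unfolding S by (intro closure_of_minimal) auto
    then have x': "x \<in> topspace X" "f x \<le> a + j * \<epsilon>" using x by auto
    \<comment> \<open>Skipping a whole level forces the values of \<open>f\<close> apart by at least
      \<epsilon>, which the choice of \<open>m\<close> excludes at small distance.\<close>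
    have "\<not> f y < a + Suc j * \<epsilon>" using k_le[OF y, of "Suc j"] j by simp
    then have "\<epsilon> \<le> \<bar>f x - f y\<bar>" using x'(2) by (simp add: algebra_simps)
    then show "1 / Suc m < d x y" using m[OF x'(1) y] by force
  qed
  then obtain h where h: "continuous_map X euclideanreal h"
    "\<And>x. real (k x) - 1 \<le> h x" "\<And>x. h x \<le> real (k x)"
    "\<And>n x y. x \<in> topspace X \<Longrightarrow> y \<in> topspace X \<Longrightarrow> d x y \<le> 1 / Suc m / 2 ^ n \<Longrightarrow> \<bar>h x - h y\<bar> \<le> 2 / 2 ^ n"
    using staircase_limit[of "1 / Suc m" k] by (metis of_nat_0_less_iff zero_less_Suc zero_less_divide_1_iff)
  \<comment> \<open>Clipping to \<open>[a, b]\<close> is 1-Lipschitz and moves no value away from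
    that of \<open>f\<close>, which already lies there.\<close>
  define g where "g x = max a (min b (a + \<epsilon> * h x))" for x
  show thesis
  proof (rule that)
    show "continuous_map X (top_of_set {a..b}) g"
      unfolding continuous_map_in_subtopology g_def using ab
      by (auto intro!: continuous_map_real_max continuous_map_real_min continuous_map_add
          continuous_map_real_mult_left h(1))
    show "\<bar>f x - g x\<bar> \<le> \<epsilon>" if x: "x \<in> topspace X" for x
    proof -
      have "f x < a + k x * \<epsilon>" using k_le[OF x] by blast
      moreover have "a + (real (k x) - 1) * \<epsilon> \<le> f x"
      proof (cases "k x")
        case 0
        then show ?thesis using fab[OF x] e by simp
      next
        case (Suc j)
        then show ?thesis using k_le[OF x, of j] by simp
      qed
      moreover have "(real (k x) - 1) * \<epsilon> \<le> h x * \<epsilon>" "h x * \<epsilon> \<le> real (k x) * \<epsilon>"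
        using h(2,3)[of x] e by (auto intro: mult_right_mono)
      moreover have "real (k x) * \<epsilon> = (real (k x) - 1) * \<epsilon> + \<epsilon>" by (simp add: algebra_simps)
      ultimately have "\<bar>f x - (a + h x * \<epsilon>)\<bar> \<le> \<epsilon>" by linarith
      then show ?thesis using fab[OF x] unfolding g_def by (auto simp: mult.commute)
    qed
    show "\<bar>g x - g y\<bar> \<le> \<epsilon> * (2 / 2 ^ n)"
      if xy: "x \<in> topspace X" "y \<in> topspace X" "d x y \<le> 1 / Suc m / 2 ^ n" for n x y
    proof -
      have "\<bar>g x - g y\<bar> \<le> \<bar>\<epsilon> * h x - \<epsilon> * h y\<bar>" unfolding g_def by linarith
      also have "\<dots> = \<epsilon> * \<bar>h x - h y\<bar>" using e by (simp add: abs_mult flip: right_diff_distrib)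
      also have "\<dots> \<le> \<epsilon> * (2 / 2 ^ n)"
        using h(4)[OF xy(1,2), of n] xy(3) e
        by (intro mult_left_mono) (simp_all only: less_imp_le)
      finally show ?thesis .
    qed
  qed
qed

end

section \<open>Uniform distances on cubes\<close>

lemma sup_dist_le:
  assumes "0 \<le> c" "\<And>\<gamma>. \<gamma> \<in> \<Delta> \<Longrightarrow> \<bar>x \<gamma> - y \<gamma>\<bar> \<le> c"
  shows "sup_dist \<Delta> x y \<le> c"
  using assms by (auto simp: sup_dist_def intro!: cSUP_least)

lemma sup_dist_bound:
  fixes a b :: real
  assumes "x \<in> \<Delta> \<rightarrow> {a..b}" "y \<in> \<Delta> \<rightarrow> {a..b}" "\<gamma> \<in> \<Delta>"
  shows "\<bar>x \<gamma> - y \<gamma>\<bar> \<le> b - a"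
proof -
  have "x \<gamma> \<in> {a..b}" "y \<gamma> \<in> {a..b}" using assms by blast+
  then show ?thesis unfolding abs_le_iff atLeastAtMost_iff by linarith
qed

lemma bdd_above_sup_dist:
  fixes a b :: real
  assumes "x \<in> \<Delta> \<rightarrow> {a..b}" "y \<in> \<Delta> \<rightarrow> {a..b}"
  shows "bdd_above ((\<lambda>\<gamma>. \<bar>x \<gamma> - y \<gamma>\<bar>) ` \<Delta>)"
  using sup_dist_bound[OF assms] by (intro bdd_aboveI2)

lemma le_sup_dist:
  assumes "x \<in> \<Delta> \<rightarrow> {a..b}" "y \<in> \<Delta> \<rightarrow> {a..b}" "\<gamma> \<in> \<Delta>"
  shows "\<bar>x \<gamma> - y \<gamma>\<bar> \<le> sup_dist \<Delta> x y"
proof -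
  have "\<Delta> \<noteq> {}" using assms(3) by blast
  then show ?thesis
    using cSUP_upper[OF assms(3) bdd_above_sup_dist[OF assms(1,2)]] by (simp add: sup_dist_def)
qed

text \<open>Strict superlevel sets of the distance become unions over coordinates, the form in which
  lower semicontinuity is checked.\<close>

lemma less_sup_dist_iff:
  assumes "x \<in> \<Delta> \<rightarrow> {a..b}" "y \<in> \<Delta> \<rightarrow> {a..b}" "\<Delta> \<noteq> {}"
  shows "r < sup_dist \<Delta> x y \<longleftrightarrow> (\<exists>\<gamma>\<in>\<Delta>. r < \<bar>x \<gamma> - y \<gamma>\<bar>)"
  using less_cSUP_iff[OF assms(3) bdd_above_sup_dist[OF assms(1,2)]] assms(3)
  by (simp add: sup_dist_def)

lemma sup_dist_nonneg:
  assumes "x \<in> \<Delta> \<rightarrow> {a..b}" "y \<in> \<Delta> \<rightarrow> {a..b}"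
  shows "0 \<le> sup_dist \<Delta> x y"
proof (cases "\<Delta> = {}")
  case False
  then obtain \<gamma> where "\<gamma> \<in> \<Delta>" by blast
  then have "\<bar>x \<gamma> - y \<gamma>\<bar> \<le> sup_dist \<Delta> x y" by (rule le_sup_dist[OF assms])
  then show ?thesis by linarith
qed (simp add: sup_dist_def)

lemma sup_dist_commute: "sup_dist \<Delta> x y = sup_dist \<Delta> y x"
  by (simp add: sup_dist_def abs_minus_commute)

lemma sup_dist_triangle:
  assumes "x \<in> \<Delta> \<rightarrow> {a..b}" "y \<in> \<Delta> \<rightarrow> {a..b}" "z \<in> \<Delta> \<rightarrow> {a..b}"
  shows "sup_dist \<Delta> x z \<le> sup_dist \<Delta> x y + sup_dist \<Delta> y z"
proof (rule sup_dist_le)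
  show "0 \<le> sup_dist \<Delta> x y + sup_dist \<Delta> y z"
    by (intro add_nonneg_nonneg sup_dist_nonneg[where a = a and b = b] assms)
  fix \<gamma> assume "\<gamma> \<in> \<Delta>"
  then have "\<bar>x \<gamma> - y \<gamma>\<bar> \<le> sup_dist \<Delta> x y" "\<bar>y \<gamma> - z \<gamma>\<bar> \<le> sup_dist \<Delta> y z"
    by (rule le_sup_dist[OF assms(1,2)], rule le_sup_dist[OF assms(2,3)])
  then show "\<bar>x \<gamma> - z \<gamma>\<bar> \<le> sup_dist \<Delta> x y + sup_dist \<Delta> y z" by linarith
qed

lemma sup_dist_restrict [simp]: "sup_dist \<Delta> (restrict x \<Delta>) (restrict y \<Delta>) = sup_dist \<Delta> x y"
  by (simp add: sup_dist_def cong: SUP_cong)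

lemma topspace_cube: "topspace (cube a b \<Gamma>) = (\<Pi>\<^sub>E \<gamma>\<in>\<Gamma>. {a..b})"
  by (simp add: cube_def)

lemma Hausdorff_cube: "Hausdorff_space (cube a b \<Gamma>)"
  unfolding cube_def by (simp add: Hausdorff_space_product_topology Hausdorff_space_subtopology)

lemma continuous_map_cube_coordinate:
  assumes "\<gamma> \<in> \<Gamma>"
  shows "continuous_map (cube a b \<Gamma>) euclideanreal (\<lambda>x. x \<gamma>)"
  using continuous_map_product_projection[OF assms, of "\<lambda>_. top_of_set {a..b}"]
  by (simp add: cube_def continuous_map_in_subtopology)

lemma in_cylinder_map_upt: "\<sigma> \<in> cylinder (map \<sigma> [0..<n])"
  by (simp add: cylinder_def)

section \<open>From continuous images to approximating compacta\<close>

text \<open>The entry \<open>u \<gamma> N\<close> stores the modulus index at precision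
  \<open>1 / 2 ^ Suc N\<close>. All \<gamma> in the cylinder of a nonempty \<open>s\<close> share
  the last entry of \<open>s\<close>, hence a common modulus, so fragmentation by \<open>d\<close>
  passes to the image.\<close>

lemma approximating_compacta_if_RN_image:
  fixes \<Gamma> :: "'g set"
  assumes ab: "a < b" and Y: "RN_compact Y"
    and f: "continuous_map Y (cube a b \<Gamma>) f" and K: "f ` topspace Y = K"
  shows "\<exists>(u :: 'g \<Rightarrow> nat \<Rightarrow> nat) (Ks :: nat list \<Rightarrow> ('g \<Rightarrow> real) set).
       (\<forall>s. compactin (cube a b \<Gamma>) (Ks s)) \<and>
       (\<forall>s. fragments (subtopology (cube a b \<Gamma>) (Ks s))
              (sup_dist {\<gamma> \<in> \<Gamma>. u \<gamma> \<in> cylinder s})) \<and>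
       (\<forall>s. length s > 0 \<longrightarrow>
          (\<forall>x\<in>K. \<exists>y\<in>Ks s.
             sup_dist {\<gamma> \<in> \<Gamma>. u \<gamma> \<in> cylinder s} x y \<le> 1 / 2 ^ length s))"
proof -
  obtain d where d: "Metric_space (topspace Y) d"
    "lower_semicontinuous_map (prod_topology Y Y) (\<lambda>(x, y). d x y)" "fragments Y d"
    and cpt: "compact_space Y" "Hausdorff_space Y"
    using Y by (auto simp: RN_compact_def)
  interpret Metric_space "topspace Y" d by (fact d(1))
  interpret lsc_compact_metric Y d by unfold_locales (use d cpt in auto)
  define P where "P \<gamma> N m g \<longleftrightarrow> continuous_map Y (top_of_set {a..b}) g \<and>
    (\<forall>x\<in>topspace Y. \<bar>f x \<gamma> - g x\<bar> \<le> 1 / 2 ^ Suc N) \<and>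
    (\<forall>n. \<forall>x\<in>topspace Y. \<forall>y\<in>topspace Y. d x y \<le> 1 / Suc m / 2 ^ n \<longrightarrow>
       \<bar>g x - g y\<bar> \<le> (1 / 2 ^ Suc N) * (2 / 2 ^ n))" for \<gamma> N and m :: nat and g
  have "\<exists>m g. P \<gamma> N m g" if \<gamma>: "\<gamma> \<in> \<Gamma>" for \<gamma> N
  proof -
    have c: "continuous_map Y euclideanreal (\<lambda>x. f x \<gamma>)"
      using continuous_map_compose[OF f continuous_map_cube_coordinate[OF \<gamma>]] by (simp add: o_def)
    have m: "f x \<gamma> \<in> {a..b}" if "x \<in> topspace Y" for x
    proof -
      have "f x \<in> topspace (cube a b \<Gamma>)" using f that by (auto simp: continuous_map_def)
      then show ?thesis using \<gamma> by (auto simp: topspace_cube)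
    qed
    have "(0::real) < 1 / 2 ^ Suc N" by simp
    from uniform_approximation[OF c less_imp_le[OF ab] m this] show ?thesis
      unfolding P_def by metis
  qed
  then have "\<forall>\<gamma>\<in>\<Gamma>. \<forall>N. \<exists>m g. P \<gamma> N m g" by blast
  then obtain u g where P: "\<And>\<gamma> N. \<gamma> \<in> \<Gamma> \<Longrightarrow> P \<gamma> N (u \<gamma> N) (g \<gamma> N)" by metis
  define \<Delta> where "\<Delta> s = {\<gamma> \<in> \<Gamma>. u \<gamma> \<in> cylinder s}" for s
  \<comment> \<open>The index \<open>length s - 1\<close> is the last one that a nonempty
    \<open>s\<close> fixes, and its precision is \<open>1 / 2 ^ length s\<close>; coordinates
    outside \<open>\<Delta> s\<close> get the constant \<open>a\<close> to stay in the cube.\<close>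
  define G where "G s x = (\<lambda>\<gamma>\<in>\<Gamma>. if \<gamma> \<in> \<Delta> s then g \<gamma> (length s - 1) x else a)" for s x
  \<comment> \<open>At \<open>[]\<close> no approximation is demanded and there is no last entry to
    supply a modulus; the empty set is compact and vacuously fragmented.\<close>
  define Ks where "Ks s = (if s = [] then {} else G s ` topspace Y)" for s
  have G: "continuous_map Y (cube a b \<Gamma>) (G s)" for s
    unfolding cube_def continuous_map_componentwise
  proof (intro conjI ballI)
    show "G s ` topspace Y \<subseteq> extensional \<Gamma>" by (auto simp: G_def)
    fix \<gamma> assume \<gamma>: "\<gamma> \<in> \<Gamma>"
    show "continuous_map Y (top_of_set {a..b}) (\<lambda>x. G s x \<gamma>)"
    proof (cases "\<gamma> \<in> \<Delta> s")
      case True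
      then have "(\<lambda>x. G s x \<gamma>) = g \<gamma> (length s - 1)" using \<gamma> by (simp add: G_def)
      then show ?thesis using P[OF \<gamma>] by (simp add: P_def)
    next
      case False
      then have "(\<lambda>x. G s x \<gamma>) = (\<lambda>x. a)" using \<gamma> by (simp add: G_def)
      then show ?thesis using ab by simp
    qed
  qed
  have cK: "compactin (cube a b \<Gamma>) (Ks s)" for s
    using image_compactin[OF _ G] cpt(1) by (simp add: Ks_def compact_space_def)
  have fr: "fragments (subtopology (cube a b \<Gamma>) (Ks s)) (sup_dist (\<Delta> s))" for s
  proof (cases "s = []")
    case True
    then show ?thesis unfolding fragments_iff Ks_def using closedin_subset by fastforce
  next
    case False
    have KG: "Ks s = G s ` topspace Y" using False by (simp add: Ks_def)
    show ?thesis
    proof (rule fragments_image[OF cpt(1) _ _ _ d(3)])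
      show "Hausdorff_space (subtopology (cube a b \<Gamma>) (Ks s))"
        by (simp add: Hausdorff_cube Hausdorff_space_subtopology)
      show "continuous_map Y (subtopology (cube a b \<Gamma>) (Ks s)) (G s)"
        using G KG by (simp add: continuous_map_in_subtopology)
      have "Ks s \<subseteq> topspace (cube a b \<Gamma>)" using cK compactin_subset_topspace by blast
      then show "G s ` topspace Y = topspace (subtopology (cube a b \<Gamma>) (Ks s))"
        using KG by auto
      fix \<epsilon> :: real assume e: "\<epsilon> > 0"
      then obtain n where "(1 / 2) ^ n < \<epsilon> / 2" using real_arch_pow_inv[of "\<epsilon> / 2" "1 / 2"] by auto
      then have n: "2 / 2 ^ n \<le> \<epsilon>" by (simp add: power_divide)
      let ?N = "length s - 1"
      \<comment> \<open>The bound on \<open>d x y\<close> involves only \<open>s\<close> and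
        \<open>n\<close>, so a single \<delta> serves all \<gamma> in
        \<open>\<Delta> s\<close>.\<close>
      have "sup_dist (\<Delta> s) (G s x) (G s y) \<le> \<epsilon>"
        if xy: "x \<in> topspace Y" "y \<in> topspace Y" "d x y \<le> 1 / Suc (s ! ?N) / 2 ^ n" for x y
      proof (rule sup_dist_le)
        fix \<gamma> assume \<gamma>: "\<gamma> \<in> \<Delta> s"
        then have "u \<gamma> ?N = s ! ?N" "\<gamma> \<in> \<Gamma>" using False by (auto simp: \<Delta>_def cylinder_def)
        then have "\<bar>g \<gamma> ?N x - g \<gamma> ?N y\<bar> \<le> (1 / 2 ^ Suc ?N) * (2 / 2 ^ n)"
          using P[of \<gamma> ?N] xy unfolding P_def by metis
        also have "\<dots> \<le> 1 * (2 / 2 ^ n)" by (intro mult_right_mono) (simp_all add: power_one_over[symmetric] power_le_one del: power_Suc)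
        finally show "\<bar>G s x \<gamma> - G s y \<gamma>\<bar> \<le> \<epsilon>" using n \<gamma> \<open>\<gamma> \<in> \<Gamma>\<close> by (simp add: G_def)
      qed (use e in simp)
      moreover have "(0::real) < 1 / Suc (s ! ?N) / 2 ^ n" by simp
      ultimately show "\<exists>\<delta>>0. \<forall>x\<in>topspace Y. \<forall>y\<in>topspace Y. d x y \<le> \<delta> \<longrightarrow>
          sup_dist (\<Delta> s) (G s x) (G s y) \<le> \<epsilon>" by blast
    qed
  qed
  have "\<exists>y\<in>Ks s. sup_dist (\<Delta> s) x y \<le> 1 / 2 ^ length s" if s: "length s > 0" and x: "x \<in> K" for s x
  proof -
    obtain z where z: "z \<in> topspace Y" "x = f z" using x K by blast
    have len: "Suc (length s - 1) = length s" using s by simp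
    have "sup_dist (\<Delta> s) x (G s z) \<le> 1 / 2 ^ length s"
    proof (rule sup_dist_le)
      fix \<gamma> assume \<gamma>: "\<gamma> \<in> \<Delta> s"
      then have "\<gamma> \<in> \<Gamma>" by (simp add: \<Delta>_def)
      then show "\<bar>x \<gamma> - G s z \<gamma>\<bar> \<le> 1 / 2 ^ length s"
        using P[of \<gamma> "length s - 1"] z \<gamma> unfolding P_def len by (simp add: G_def)
    qed simp
    moreover have "G s z \<in> Ks s" using s z by (simp add: Ks_def)
    ultimately show ?thesis by blast
  qed
  then show ?thesis using cK fr unfolding \<Delta>_def by (intro exI[of _ u] exI[of _ Ks]) blast
qed

section \<open>From approximating compacta to continuous images\<close>

lemma RN_image_if_approximating_compacta:
  fixes \<Gamma> :: "'g set" and u :: "'g \<Rightarrow> nat \<Rightarrow> nat" and Ks :: "nat list \<Rightarrow> ('g \<Rightarrow> real) set"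
  assumes ab: "a < b" and K: "compactin (cube a b \<Gamma>) K"
    and Ks: "\<And>s. compactin (cube a b \<Gamma>) (Ks s)"
    and fr: "\<And>s. fragments (subtopology (cube a b \<Gamma>) (Ks s)) (sup_dist {\<gamma> \<in> \<Gamma>. u \<gamma> \<in> cylinder s})"
    and near: "\<And>s x. length s > 0 \<Longrightarrow> x \<in> K \<Longrightarrow>
      \<exists>y\<in>Ks s. sup_dist {\<gamma> \<in> \<Gamma>. u \<gamma> \<in> cylinder s} x y \<le> 1 / 2 ^ length s"
  shows "RN_image (subtopology (cube a b \<Gamma>) K)"
proof -

  \<comment> \<open>The factors, restricted to the coordinates they control\<close>
  define \<Delta> where "\<Delta> s = {\<gamma> \<in> \<Gamma>. u \<gamma> \<in> cylinder s}" for s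
  have \<Delta>\<Gamma>: "\<Delta> s \<subseteq> \<Gamma>" for s by (auto simp: \<Delta>_def)
  have \<Delta>Nil: "\<Delta> [] = \<Gamma>" by (simp add: \<Delta>_def cylinder_def)
  \<comment> \<open>The index \<open>[]\<close> is free, since no approximation is required there; it carries \<open>K\<close> itself.\<close>
  define Q where "Q s = (if s = [] then K else (\<lambda>y. restrict y (\<Delta> s)) ` Ks s)" for s
  define P where "P s = subtopology (cube a b (\<Delta> s)) (Q s)" for s
  have restr: "continuous_map (cube a b \<Gamma>) (cube a b (\<Delta> s)) (\<lambda>y. restrict y (\<Delta> s))" for s
    unfolding cube_def continuous_map_componentwise
    using \<Delta>\<Gamma>[of s] by (auto intro!: continuous_map_product_projection)
  have cQ: "compactin (cube a b (\<Delta> s)) (Q s)" for s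
    using image_compactin[OF Ks restr] K by (auto simp: Q_def \<Delta>Nil)
  have tP: "topspace (P s) = Q s" for s
    using compactin_subset_topspace[OF cQ] by (auto simp: P_def)
  have HP: "Hausdorff_space (P s)" for s by (simp add: P_def Hausdorff_cube Hausdorff_space_subtopology)
  \<comment> \<open>Restricting to \<open>\<Delta> s\<close> leaves
    \<open>sup_dist (\<Delta> s)\<close> unchanged and makes it separate points, so fragmentation
    passes to the image with \<delta> = \<epsilon>.\<close>
  have frP: "fragments (P s) (sup_dist (\<Delta> s))" if "s \<noteq> []" for s
  proof (rule fragments_image[OF _ HP])
    let ?X = "subtopology (cube a b \<Gamma>) (Ks s)"
    show "compact_space ?X" using Ks by (simp add: compact_space_subtopology)
    show "fragments ?X (sup_dist (\<Delta> s))" using fr by (simp add: \<Delta>_def)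
    have tX: "topspace ?X = Ks s" using compactin_subset_topspace[OF Ks] by auto
    show "continuous_map ?X (P s) (\<lambda>y. restrict y (\<Delta> s))"
      unfolding P_def using continuous_map_from_subtopology[OF restr] that tX
      by (auto simp: continuous_map_in_subtopology Q_def)
    show "(\<lambda>y. restrict y (\<Delta> s)) ` topspace ?X = topspace (P s)"
      unfolding tX tP using that by (simp add: Q_def)
    show "\<exists>\<delta>>0. \<forall>x\<in>topspace ?X. \<forall>y\<in>topspace ?X. sup_dist (\<Delta> s) x y \<le> \<delta> \<longrightarrow>
        sup_dist (\<Delta> s) (restrict x (\<Delta> s)) (restrict y (\<Delta> s)) \<le> \<epsilon>" if "\<epsilon> > 0" for \<epsilon>
      using that by auto
  qed

  \<comment> \<open>The compact space of compatible families\<close>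
  define Y0 where "Y0 = product_topology P UNIV"
  have cY0: "compact_space Y0"
    unfolding Y0_def compact_space_product_topology P_def using cQ by (simp add: compact_space_subtopology)
  have HY0: "Hausdorff_space Y0"
    unfolding Y0_def using HP by (simp add: Hausdorff_space_product_topology)
  have z_in: "z s \<in> topspace (cube a b (\<Delta> s))" if "z \<in> topspace Y0" for z s
    using that compactin_subset_topspace[OF cQ] tP by (fastforce simp: Y0_def PiE_iff)
  then have z_range: "z s \<in> \<Delta> s \<rightarrow> {a..b}" if "z \<in> topspace Y0" for z s
    using that[THEN z_in, of s] by (simp add: topspace_cube PiE_def)
  have projP: "continuous_map Y0 (P s) (\<lambda>z. z s)" for s
    unfolding Y0_def by (rule continuous_map_product_projection) simp
  then have proj: "continuous_map Y0 (cube a b (\<Delta> s)) (\<lambda>z. z s)" for s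
    by (simp add: P_def continuous_map_in_subtopology)
  have coord: "continuous_map Y0 euclideanreal (\<lambda>z. z s \<gamma>)" if "\<gamma> \<in> \<Delta> s" for s \<gamma>
    using continuous_map_compose[OF proj continuous_map_cube_coordinate[OF that]] by (simp add: o_def)

  define T where "T = {z \<in> topspace Y0. \<forall>s. s \<noteq> [] \<longrightarrow> (\<forall>\<gamma>\<in>\<Delta> s. \<bar>z [] \<gamma> - z s \<gamma>\<bar> \<le> 1 / 2 ^ length s)}"
  have "closedin Y0 T"
  proof -
    have "closedin Y0 {z \<in> topspace Y0. \<bar>z [] \<gamma> - z s \<gamma>\<bar> \<in> {..1 / 2 ^ length s}}"
      if "\<gamma> \<in> \<Delta> s" for s \<gamma>
      using that \<Delta>\<Gamma>[of s]
      by (intro closedin_continuous_map_preimage[where Y = euclideanreal] continuous_map_real_abs continuous_map_diff coord)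
        (auto simp: \<Delta>Nil)
    \<comment> \<open>Intersecting with \<open>topspace Y0\<close> keeps the set inside the space
      even if there are no conditions at all.\<close>
    then have "closedin Y0 (topspace Y0 \<inter> (\<Inter>(s, \<gamma>)\<in>{(s, \<gamma>). s \<noteq> [] \<and> \<gamma> \<in> \<Delta> s}.
        {z \<in> topspace Y0. \<bar>z [] \<gamma> - z s \<gamma>\<bar> \<in> {..1 / 2 ^ length s}}))"
      by (cases "{(s, \<gamma>). s \<noteq> [] \<and> \<gamma> \<in> \<Delta> s} = {}")
        (auto simp only: INT_empty Int_UNIV_right closedin_topspace intro!: closedin_Int closedin_INT)
    moreover have "topspace Y0 \<inter> (\<Inter>(s, \<gamma>)\<in>{(s, \<gamma>). s \<noteq> [] \<and> \<gamma> \<in> \<Delta> s}.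
        {z \<in> topspace Y0. \<bar>z [] \<gamma> - z s \<gamma>\<bar> \<in> {..1 / 2 ^ length s}}) = T"
      unfolding T_def by auto
    ultimately show ?thesis by simp
  qed
  define Y where "Y = subtopology Y0 T"
  have TY0: "T \<subseteq> topspace Y0" by (auto simp: T_def)
  then have tY: "topspace Y = T" by (auto simp: Y_def)
  have cY: "compact_space Y"
    unfolding Y_def using cY0 \<open>closedin Y0 T\<close> by (simp add: closedin_compact_space compact_space_subtopology)
  have HY: "Hausdorff_space Y" unfolding Y_def using HY0 by (rule Hausdorff_space_subtopology)
  have range: "z s \<in> \<Delta> s \<rightarrow> {a..b}" if "z \<in> T" for z s using that TY0 z_range by blast

  \<comment> \<open>A weighted supremum metric\<close>
  define w :: "nat list \<Rightarrow> real" where "w s = 1 / 2 ^ to_nat s" for s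
  have w: "0 < w s" "w s \<le> 1" for s
    by (simp_all add: w_def power_one_over[symmetric] power_le_one)
  define e where "e s z z' = sup_dist (\<Delta> s) (z s) (z' s)" for s and z z' :: "nat list \<Rightarrow> 'g \<Rightarrow> real"
  \<comment> \<open>The index \<open>[]\<close> is left out: the distance on \<Gamma> is not known
    to fragment \<open>K\<close>, and the other coordinates determine the one at
    \<open>[]\<close>.\<close>
  define D where "D z z' = (SUP s\<in>- {[]}. w s * e s z z')" for z z'
  have e0: "0 \<le> e s z z'" if "z \<in> T" "z' \<in> T" for s z z'
    unfolding e_def by (rule sup_dist_nonneg[OF range[OF that(1)] range[OF that(2)]])
  have eb: "e s z z' \<le> b - a" if "z \<in> T" "z' \<in> T" for s z z'
    unfolding e_def using ab sup_dist_bound[OF range[OF that(1)] range[OF that(2)]]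
    by (intro sup_dist_le) auto
  have web: "w s * e s z z' \<le> b - a" if "z \<in> T" "z' \<in> T" for s z z'
    using mult_mono[OF w(2)[of s] eb[OF that, of s]] e0[OF that, of s] by simp
  have bdd: "bdd_above ((\<lambda>s. w s * e s z z') ` (- {[]}))" if "z \<in> T" "z' \<in> T" for z z'
    using web[OF that] by (intro bdd_aboveI2)
  have ne: "- {[] :: nat list} \<noteq> {}" by (metis ComplI empty_iff list.distinct(1) singletonD)
  have D_up: "w s * e s z z' \<le> D z z'" if "z \<in> T" "z' \<in> T" "s \<noteq> []" for s z z'
    unfolding D_def using that bdd by (intro cSUP_upper) auto
  have D_le: "D z z' \<le> c" if "\<And>s. s \<noteq> [] \<Longrightarrow> w s * e s z z' \<le> c" for z z' c
    unfolding D_def using ne that by (intro cSUP_least) auto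
  have D_less: "r < D z z' \<longleftrightarrow> (\<exists>s\<in>- {[]}. r < w s * e s z z')" if "z \<in> T" "z' \<in> T" for r z z'
    unfolding D_def by (rule less_cSUP_iff[OF ne bdd[OF that]])
  have D0: "0 \<le> D z z'" if "z \<in> T" "z' \<in> T" for z z'
  proof -
    have "0 \<le> w [0] * e [0] z z'" by (rule mult_nonneg_nonneg[OF less_imp_le[OF w(1)] e0[OF that]])
    also have "\<dots> \<le> D z z'" by (rule D_up[OF that]) simp
    finally show ?thesis .
  qed

  \<comment> \<open>The value at \<open>[]\<close> and \<gamma> is the limit of the values at
    \<gamma> for the prefixes \<open>t\<close> of \<open>u \<gamma>\<close>, since \<gamma> lies in
    every such \<open>\<Delta> t\<close>. These agree for \<open>z\<close> and \<open>z'\<close>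
    when \<open>D\<close> vanishes.\<close>
  have eq: "z = z'" if z: "z \<in> T" "z' \<in> T" and D: "D z z' = 0" for z z'
  proof
    fix s
    have coord_eq: "z s \<gamma> = z' s \<gamma>" if "s \<noteq> []" "\<gamma> \<in> \<Delta> s" for s \<gamma>
    proof -
      have "w s * e s z z' \<le> 0" using D_up[OF z that(1)] D by simp
      then have "e s z z' \<le> 0" using w(1)[of s] by (simp add: mult_le_0_iff)
      then have "\<bar>z s \<gamma> - z' s \<gamma>\<bar> \<le> 0"
        using le_sup_dist[OF range[OF z(1)] range[OF z(2)] that(2)] unfolding e_def by linarith
      then show ?thesis by simp
    qed
    have "z s \<gamma> = z' s \<gamma>" if \<gamma>: "\<gamma> \<in> \<Delta> s" for \<gamma>
    proof (cases "s = []")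
      case True
      then have g: "\<gamma> \<in> \<Gamma>" using \<gamma> \<Delta>\<Gamma> by blast
      have "\<bar>z [] \<gamma> - z' [] \<gamma>\<bar> \<le> \<epsilon>" if pos: "\<epsilon> > 0" for \<epsilon>
      proof -
        obtain n where "(1 / 2) ^ n < \<epsilon>" using real_arch_pow_inv[OF pos, of "1 / 2"] by auto
        then have n: "2 / 2 ^ Suc n \<le> \<epsilon>" by (simp add: power_divide)
        define t where "t = map (u \<gamma>) [0..<Suc n]"
        have t: "t \<noteq> []" "length t = Suc n" "\<gamma> \<in> \<Delta> t"
          using g by (simp_all add: t_def \<Delta>_def in_cylinder_map_upt del: upt_Suc)
        have "\<bar>z [] \<gamma> - z t \<gamma>\<bar> \<le> 1 / 2 ^ Suc n" "\<bar>z' [] \<gamma> - z' t \<gamma>\<bar> \<le> 1 / 2 ^ Suc n"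
          using z t unfolding T_def by auto
        then show ?thesis using coord_eq[OF t(1,3)] n by linarith
      qed
      then have "\<bar>z [] \<gamma> - z' [] \<gamma>\<bar> \<le> 0" using field_le_epsilon[of "\<bar>z [] \<gamma> - z' [] \<gamma>\<bar>" 0] by simp
      then show ?thesis using True by simp
    qed (use coord_eq \<gamma> in blast)
    moreover have "z s \<in> extensional (\<Delta> s)" "z' s \<in> extensional (\<Delta> s)"
      using z_in[of z s] z_in[of z' s] z TY0 by (auto simp: topspace_cube PiE_def)
    ultimately show "z s = z' s" by (auto intro: extensionalityI)
  qed

  \<comment> \<open>\<open>Metric_space\<close> demands nonnegativity and symmetry off the carrier as well, where the
    supremum may be a junk value.\<close>
  define D' where "D' z z' = (if z \<in> T \<and> z' \<in> T then D z z' else 0)" for z z'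
  have metric: "Metric_space (topspace Y) D'"
    unfolding tY
  proof
    show "0 \<le> D' z z'" for z z' using D0 by (simp add: D'_def)
    show "D' z z' = D' z' z" for z z'
      by (simp add: D'_def D_def e_def sup_dist_commute)
    show "(D' z z' = 0) = (z = z')" if "z \<in> T" "z' \<in> T" for z z'
    proof
      assume "D' z z' = 0"
      then show "z = z'" using eq that by (simp add: D'_def)
    next
      assume "z = z'"
      moreover have "e s z z = 0" for s by (simp add: e_def sup_dist_def)
      ultimately show "D' z z' = 0" using ne by (simp add: D'_def D_def)
    qed
    show "D' x z \<le> D' x y + D' y z" if T: "x \<in> T" "y \<in> T" "z \<in> T" for x y z
    proof -
      have "w s * e s x z \<le> D x y + D y z" if s: "s \<noteq> []" for s
      proof -
        have "e s x z \<le> e s x y + e s y z"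
          unfolding e_def by (rule sup_dist_triangle) (use range T in auto)
        then have "w s * e s x z \<le> w s * e s x y + w s * e s y z"
          using w(1)[of s] by (simp flip: distrib_left)
        then show ?thesis using D_up[OF T(1,2) s] D_up[OF T(2,3) s] by linarith
      qed
      then show ?thesis using T D_le by (simp add: D'_def)
    qed
  qed

  \<comment> \<open>Lower semicontinuity of the metric\<close>
  let ?YY = "prod_topology Y Y"
  have coord2: "continuous_map ?YY euclideanreal (\<lambda>p. \<bar>fst p s \<gamma> - snd p s \<gamma>\<bar>)" if "\<gamma> \<in> \<Delta> s" for s \<gamma>
  proof -
    have c: "continuous_map Y euclideanreal (\<lambda>z. z s \<gamma>)"
      unfolding Y_def by (rule continuous_map_from_subtopology[OF coord[OF that]])
    show ?thesis
      using continuous_map_compose[OF continuous_map_fst c] continuous_map_compose[OF continuous_map_snd c]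
      by (intro continuous_map_real_abs continuous_map_diff) (simp_all add: o_def)
  qed
  \<comment> \<open>A superlevel set is a union of preimages of open half-lines under continuous
    coordinate differences; without coordinates the distance is constantly \<open>0\<close>.\<close>
  have lsc_e: "openin ?YY {p \<in> topspace ?YY. r < w s * e s (fst p) (snd p)}" for r s
  proof (cases "\<Delta> s = {}")
    case True
    then show ?thesis by (cases "r < 0") (simp_all add: e_def sup_dist_def flip: topspace_prod_topology)
  next
    case False
    have "{p \<in> topspace ?YY. r < w s * e s (fst p) (snd p)} =
        (\<Union>\<gamma>\<in>\<Delta> s. {p \<in> topspace ?YY. \<bar>fst p s \<gamma> - snd p s \<gamma>\<bar> \<in> {r / w s<..}})"
    proof (intro set_eqI)
      fix p
      have "r < w s * e s (fst p) (snd p) \<longleftrightarrow> (\<exists>\<gamma>\<in>\<Delta> s. r / w s < \<bar>fst p s \<gamma> - snd p s \<gamma>\<bar>)"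
        if "fst p \<in> T" "snd p \<in> T"
        using less_sup_dist_iff[OF range[OF that(1)] range[OF that(2)] False, of "r / w s"] w(1)[of s]
        by (simp add: e_def pos_divide_less_eq mult.commute)
      then show "p \<in> {p \<in> topspace ?YY. r < w s * e s (fst p) (snd p)} \<longleftrightarrow>
        p \<in> (\<Union>\<gamma>\<in>\<Delta> s. {p \<in> topspace ?YY. \<bar>fst p s \<gamma> - snd p s \<gamma>\<bar> \<in> {r / w s<..}})"
        using tY by auto
    qed
    moreover have "openin ?YY {p \<in> topspace ?YY. \<bar>fst p s \<gamma> - snd p s \<gamma>\<bar> \<in> {r / w s<..}}"
      if "\<gamma> \<in> \<Delta> s" for \<gamma>
      by (rule openin_continuous_map_preimage[OF coord2[OF that]]) simp
    ultimately show ?thesis by (simp only:) (rule openin_Union, blast)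
  qed
  have lsc: "lower_semicontinuous_map ?YY (\<lambda>(z, z'). D' z z')"
    unfolding lower_semicontinuous_map_def
  proof
    fix r
    have "{p \<in> topspace ?YY. r < (case p of (z, z') \<Rightarrow> D' z z')} =
        (\<Union>s\<in>- {[]}. {p \<in> topspace ?YY. r < w s * e s (fst p) (snd p)})"
      using D_less tY by (auto simp: D'_def)
    then show "openin ?YY {p \<in> topspace ?YY. r < (case p of (z, z') \<Rightarrow> D' z z')}"
      using lsc_e by (simp only:) (rule openin_Union, blast)
  qed

  \<comment> \<open>Fragmentation by the weighted metric\<close>
  have "fragments Y D'"
  proof (rule fragments_countable_sup[where I = "- {[]}" and d = e])
    fix s :: "nat list" assume "s \<in> - {[]}"
    then have "fragments (P s) (sup_dist (\<Delta> s))" using frP by simp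
    moreover have "continuous_map Y (P s) (\<lambda>z. z s)"
      unfolding Y_def by (rule continuous_map_from_subtopology[OF projP])
    ultimately have "fragments Y (\<lambda>z z'. sup_dist (\<Delta> s) (z s) (z' s))"
      using fragments_pullback[OF cY HP[of s]] by blast
    then show "fragments Y (e s)" by (simp add: e_def[abs_def])
  next
    fix \<epsilon> :: real assume \<epsilon>: "\<epsilon> > 0"
    then have "\<epsilon> / (b - a) > 0" using ab by simp
    then obtain N where N: "(1 / 2) ^ N < \<epsilon> / (b - a)"
      using real_arch_pow_inv[of "\<epsilon> / (b - a)" "1 / 2"] by auto
    \<comment> \<open>For the other nonempty \<open>s\<close> the weight is at most
      \<open>(1 / 2) ^ N\<close>, and as no distance exceeds \<open>b - a\<close>, the choice of
      \<open>N\<close> keeps the weighted distance below \<epsilon>.\<close>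
    let ?F = "{s :: nat list. s \<noteq> [] \<and> to_nat s < N}"
    have "finite (to_nat -` {..<N} :: nat list set)" by (rule finite_vimageI) (simp_all add: inj_to_nat)
    then have "finite ?F" by (rule rev_finite_subset) auto
    moreover have "D' z z' \<le> \<epsilon>"
      if z: "z \<in> topspace Y" "z' \<in> topspace Y" and F: "\<forall>s\<in>?F. e s z z' \<le> \<epsilon>" for z z'
    proof -
      have zT: "z \<in> T" "z' \<in> T" using z tY by auto
      have "w s * e s z z' \<le> \<epsilon>" if s: "s \<noteq> []" for s
      proof (cases "to_nat s < N")
        case True
        then have "e s z z' \<le> \<epsilon>" using F s by simp
        then show ?thesis using mult_mono[OF w(2)[of s], of "e s z z'" \<epsilon>] e0[OF zT, of s] by simp
      next
        case False
        then have "w s \<le> (1 / 2) ^ N" unfolding w_def power_one_over[symmetric]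
          by (intro power_decreasing) auto
        then have "w s * e s z z' \<le> (1 / 2) ^ N * (b - a)"
          using eb[OF zT, of s] e0[OF zT, of s] by (intro mult_mono) auto
        also have "\<dots> \<le> \<epsilon>" using N ab by (simp add: pos_less_divide_eq less_imp_le)
        finally show ?thesis .
      qed
      then show ?thesis using zT D_le by (simp add: D'_def)
    qed
    ultimately show "\<exists>F\<subseteq>- {[]}. finite F \<and> (\<forall>x\<in>topspace Y. \<forall>y\<in>topspace Y.
        (\<forall>s\<in>F. e s x y \<le> \<epsilon>) \<longrightarrow> D' x y \<le> \<epsilon>)"
      by (intro exI[of _ ?F]) auto
  qed
  then have RN: "RN_compact Y"
    unfolding RN_compact_def using cY HY metric lsc by blast

  \<comment> \<open>Projection onto the given compact set\<close>
  have "continuous_map Y (subtopology (cube a b \<Gamma>) K) (\<lambda>z. z [])"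
    unfolding Y_def using continuous_map_from_subtopology[OF projP[of "[]"]]
    by (simp add: P_def Q_def \<Delta>Nil)
  moreover have "(\<lambda>z. z []) ` topspace Y = topspace (subtopology (cube a b \<Gamma>) K)"
  proof -
    have "K \<subseteq> (\<lambda>z. z []) ` T"
    proof
      fix x assume x: "x \<in> K"
      have "\<forall>s. \<exists>y. s \<noteq> [] \<longrightarrow> y \<in> Ks s \<and> sup_dist (\<Delta> s) x y \<le> 1 / 2 ^ length s"
        using near[OF _ x] unfolding \<Delta>_def by (metis length_greater_0_conv)
      then obtain y where "\<forall>s. s \<noteq> [] \<longrightarrow> y s \<in> Ks s \<and> sup_dist (\<Delta> s) x (y s) \<le> 1 / 2 ^ length s"
        by (elim choice[THEN exE])
      then have y: "\<And>s. s \<noteq> [] \<Longrightarrow> y s \<in> Ks s"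
        "\<And>s. s \<noteq> [] \<Longrightarrow> sup_dist (\<Delta> s) x (y s) \<le> 1 / 2 ^ length s"
        by simp_all
      \<comment> \<open>A point over \<open>x\<close> consists of \<open>x\<close> itself and a
        chosen approximant from each \<open>Ks s\<close>, restricted to
        \<open>\<Delta> s\<close>.\<close>
      define z where "z s = (if s = [] then x else restrict (y s) (\<Delta> s))" for s
      have "z \<in> topspace Y0"
        unfolding Y0_def using x y(1) by (auto simp: tP z_def Q_def)
      moreover have "\<bar>z [] \<gamma> - z s \<gamma>\<bar> \<le> 1 / 2 ^ length s" if s: "s \<noteq> []" "\<gamma> \<in> \<Delta> s" for s \<gamma>
      proof -
        have "x \<in> topspace (cube a b \<Gamma>)" "y s \<in> topspace (cube a b \<Gamma>)"
          using x y(1)[OF s(1)] compactin_subset_topspace[OF K] compactin_subset_topspace[OF Ks] by blast+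
        then have "x \<in> \<Delta> s \<rightarrow> {a..b}" "y s \<in> \<Delta> s \<rightarrow> {a..b}"
          using \<Delta>\<Gamma>[of s] by (auto simp: topspace_cube)
        then have "\<bar>x \<gamma> - y s \<gamma>\<bar> \<le> sup_dist (\<Delta> s) x (y s)" using s(2) by (rule le_sup_dist)
        then show ?thesis using y(2)[OF s(1)] s by (simp add: z_def)
      qed
      ultimately have "z \<in> T" by (simp add: T_def)
      then have "z [] \<in> (\<lambda>z. z []) ` T" by (rule imageI)
      then show "x \<in> (\<lambda>z. z []) ` T" by (simp add: z_def)
    qed
    moreover have "z [] \<in> K" if "z \<in> T" for z
    proof -
      have "z \<in> topspace Y0" using that TY0 by blast
      then have "z [] \<in> topspace (P [])" using projP[of "[]"] by (auto simp: continuous_map_def)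
      then show ?thesis by (simp add: tP Q_def)
    qed
    moreover have "topspace (subtopology (cube a b \<Gamma>) K) = K"
      using compactin_subset_topspace[OF K] by auto
    ultimately show ?thesis unfolding tY by blast
  qed
  ultimately show ?thesis by (rule RN_image_if_RN_compact[OF RN])
qed

theorem theorem5:
  fixes a b :: real and \<Gamma> :: "'g set" and K :: "('g \<Rightarrow> real) set"
  assumes "a < b"
    and "compactin (cube a b \<Gamma>) K"
  shows "RN_image (subtopology (cube a b \<Gamma>) K) \<longleftrightarrow>
    (\<exists>(u :: 'g \<Rightarrow> nat \<Rightarrow> nat) (Ks :: nat list \<Rightarrow> ('g \<Rightarrow> real) set).
       (\<forall>s. compactin (cube a b \<Gamma>) (Ks s)) \<and>
       (\<forall>s. fragments (subtopology (cube a b \<Gamma>) (Ks s))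
              (sup_dist {\<gamma> \<in> \<Gamma>. u \<gamma> \<in> cylinder s})) \<and>
       (\<forall>s. length s > 0 \<longrightarrow>
          (\<forall>x\<in>K. \<exists>y\<in>Ks s.
             sup_dist {\<gamma> \<in> \<Gamma>. u \<gamma> \<in> cylinder s} x y \<le> 1 / 2 ^ length s)))"
  (is "?L \<longleftrightarrow> ?R")
proof
  assume ?L
  then obtain Y :: "('g \<Rightarrow> real) set set topology" and f where Y: "RN_compact Y"
    and f: "continuous_map Y (subtopology (cube a b \<Gamma>) K) f"
    and im: "f ` topspace Y = topspace (subtopology (cube a b \<Gamma>) K)"
    unfolding RN_image_def by (elim exE conjE)
  have "continuous_map Y (cube a b \<Gamma>) f" using f by (simp add: continuous_map_in_subtopology)
  moreover have "f ` topspace Y = K" using im compactin_subset_topspace[OF assms(2)] by auto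
  ultimately show ?R by (rule approximating_compacta_if_RN_image[OF assms(1) Y])
next
  assume ?R
  then obtain u Ks where "\<forall>s. compactin (cube a b \<Gamma>) (Ks s)"
    "\<forall>s. fragments (subtopology (cube a b \<Gamma>) (Ks s)) (sup_dist {\<gamma> \<in> \<Gamma>. u \<gamma> \<in> cylinder s})"
    "\<forall>s. length s > 0 \<longrightarrow> (\<forall>x\<in>K. \<exists>y\<in>Ks s.
       sup_dist {\<gamma> \<in> \<Gamma>. u \<gamma> \<in> cylinder s} x y \<le> 1 / 2 ^ length s)"
    by (elim exE conjE)
  then show ?L by (intro RN_image_if_approximating_compacta[OF assms, of Ks u]) simp_all
qed

end
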